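(* Let $g\in(0,\infty)$ and $h\in(-\infty,0)$ be nonrandom constants. Let $(Z_t)_{t\ge 0}$ be a continuous $\mathcal F$-adapted local martingale with nonrandom quadratic variation $\langle Z\rangle$, such that $Z_0=0$ and $\langle Z\rangle_\infty=\infty$. Let $W$ be a standard Wiener process. Then $$P_{g,h}^Z(t)=P_{g,h}^W\big(\langle Z\rangle_t\big)\qquad\text{for all } t\ge 0.$$
   Context: Work on a complete stochastic basis $(\Omega,\mathbb P,\Sigma,\mathcal F)$, where $\mathcal F=(\mathcal F_t)_{t\ge0}$ is a filtration. For an $\mathcal F$-adapted continuous process $X$ with $X_0=0$ and constants $h<0<g$, the first-passage time is $\mathrm T_{g,h}^X=\inf\{t\ge 0: X_t\ge g\text{ or }X_t\le h\}$, and the boundary crossing probability is $P_{g,h}^X(t)=\mathbb P(\mathrm T_{g,h}^X\le t)=\mathbb P(\sup_{0\le s\le t}X_s\ge g\text{ or }\inf_{0\le s\le t}X_s\le h)$ for $t\ge0$. "Nonrandom quadratic variation" means that $t\mapsto\langle Z\rangle_t$ is a (time-varying) deterministic function, and $\langle Z\rangle_\infty=\lim_{t\to\infty}\langle Z\rangle_t$. The Wiener process $W$ is $\mathcal F$-adapted. *)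

theory Defs
  imports "HOL-Probability.Probability"
begin

text \<open>
  Processes are functions \<open>X :: real \<Rightarrow> 'a \<Rightarrow> real\<close> (time first); only their values at times \<open>t \<ge> 0\<close>
  are ever used. Filtrations are likewise only relevant on \<open>{0..}\<close>. Path properties
  are required almost surely.
\<close>

text \<open>
  Complete stochastic basis: the probability space is complete and \<open>F 0\<close>, hence every \<open>F t\<close>,
  contains all null sets. Right-continuity of the filtration is not imposed.
\<close>

locale stochastic_basis = prob_space M + complete_measure M for M :: "'a measure" +
  fixes F :: "real \<Rightarrow> 'a measure"
  assumes subalgebra_F: "0 \<le> t \<Longrightarrow> subalgebra M (F t)"
    and F_mono: "0 \<le> s \<Longrightarrow> s \<le> t \<Longrightarrow> sets (F s) \<subseteq> sets (F t)"
    and null_sets_F: "null_sets M \<subseteq> sets (F 0)"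

definition adapted_process :: "(real \<Rightarrow> 'a measure) \<Rightarrow> (real \<Rightarrow> 'a \<Rightarrow> real) \<Rightarrow> bool" where
  "adapted_process F X \<longleftrightarrow> (\<forall>t\<ge>0. X t \<in> borel_measurable (F t))"

definition continuous_process :: "'a measure \<Rightarrow> (real \<Rightarrow> 'a \<Rightarrow> real) \<Rightarrow> bool" where
  "continuous_process M X \<longleftrightarrow> (AE \<omega> in M. continuous_on {0..} (\<lambda>t. X t \<omega>))"

definition martingale :: "'a measure \<Rightarrow> (real \<Rightarrow> 'a measure) \<Rightarrow> (real \<Rightarrow> 'a \<Rightarrow> real) \<Rightarrow> bool" where
  "martingale M F X \<longleftrightarrow>
     adapted_process F X \<and> (\<forall>t\<ge>0. integrable M (X t)) \<and>
     (\<forall>s\<ge>0. \<forall>t\<ge>s. AE \<omega> in M. real_cond_exp M (F s) (X t) \<omega> = X s \<omega>)"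

text \<open>
  Stopping times with values in \<open>[0,\<infinity>]\<close> for a filtration indexed by \<open>[0,\<infinity>)\<close>. The library's
  \<^const>\<open>stopping_time\<close> takes values in the index type of the filtration, which excludes \<open>\<infinity>\<close>.
\<close>

definition extended_stopping_time :: "(real \<Rightarrow> 'a measure) \<Rightarrow> ('a \<Rightarrow> ennreal) \<Rightarrow> bool" where
  "extended_stopping_time F \<tau> \<longleftrightarrow> (\<forall>t\<ge>0. Measurable.pred (F t) (\<lambda>\<omega>. \<tau> \<omega> \<le> ennreal t))"

definition stopped_process :: "(real \<Rightarrow> 'a \<Rightarrow> real) \<Rightarrow> ('a \<Rightarrow> ennreal) \<Rightarrow> real \<Rightarrow> 'a \<Rightarrow> real" where
  "stopped_process X \<tau> t \<omega> = X (enn2real (min (ennreal t) (\<tau> \<omega>))) \<omega>"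

definition local_martingale :: "'a measure \<Rightarrow> (real \<Rightarrow> 'a measure) \<Rightarrow> (real \<Rightarrow> 'a \<Rightarrow> real) \<Rightarrow> bool" where
  "local_martingale M F X \<longleftrightarrow>
     adapted_process F X \<and>
     (\<exists>\<tau> :: nat \<Rightarrow> 'a \<Rightarrow> ennreal.
        (\<forall>n. extended_stopping_time F (\<tau> n)) \<and>
        (AE \<omega> in M. incseq (\<lambda>n. \<tau> n \<omega>) \<and> (\<lambda>n. \<tau> n \<omega>) \<longlonglongrightarrow> \<infinity>) \<and>
        (\<forall>n. martingale M F (\<lambda>t \<omega>. stopped_process X (\<tau> n) t \<omega> - X 0 \<omega>)))"

text \<open>
  \<open>V\<close> is a version of the quadratic variation \<open>\<langle>X\<rangle>\<close> of the continuous local martingale \<open>X\<close>: the (up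
  to indistinguishability unique) continuous adapted increasing process, null at \<open>0\<close>, for which
  \<open>X\<^sup>2 - V\<close> is a local martingale.
\<close>

definition is_quadratic_variation ::
    "'a measure \<Rightarrow> (real \<Rightarrow> 'a measure) \<Rightarrow> (real \<Rightarrow> 'a \<Rightarrow> real) \<Rightarrow> (real \<Rightarrow> 'a \<Rightarrow> real) \<Rightarrow> bool" where
  "is_quadratic_variation M F X V \<longleftrightarrow>
     adapted_process F V \<and> continuous_process M V \<and>
     (AE \<omega> in M. V 0 \<omega> = 0 \<and> mono_on {0..} (\<lambda>t. V t \<omega>)) \<and>
     local_martingale M F (\<lambda>t \<omega>. (X t \<omega>)\<^sup>2 - V t \<omega>)"

text \<open>
  Independence of increments is independence of the increments over consecutive disjoint
  intervals, so the notion does not refer to a filtration. The second parameter of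
  \<^const>\<open>normal_density\<close> is the standard deviation.
\<close>

definition wiener_process :: "'a measure \<Rightarrow> (real \<Rightarrow> 'a \<Rightarrow> real) \<Rightarrow> bool" where
  "wiener_process M W \<longleftrightarrow>
     continuous_process M W \<and>
     (AE \<omega> in M. W 0 \<omega> = 0) \<and>
     (\<forall>n. \<forall>t :: nat \<Rightarrow> real. 0 \<le> t 0 \<and> (\<forall>i<n. t i < t (Suc i)) \<longrightarrow>
        prob_space.indep_vars M (\<lambda>_. borel) (\<lambda>i \<omega>. W (t (Suc i)) \<omega> - W (t i) \<omega>) {..<n}) \<and>
     (\<forall>s\<ge>0. \<forall>t>s. distributed M lborel (\<lambda>\<omega>. W t \<omega> - W s \<omega>) (normal_density 0 (sqrt (t - s))))"

text \<open>The infimum is taken in \<^typ>\<open>ennreal\<close>, so it is \<open>\<infinity>\<close> if the path never leaves \<open>(h,g)\<close>.\<close>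

definition first_passage_time :: "(real \<Rightarrow> 'a \<Rightarrow> real) \<Rightarrow> real \<Rightarrow> real \<Rightarrow> 'a \<Rightarrow> ennreal" where
  "first_passage_time X g h \<omega> = Inf {ennreal t |t. 0 \<le> t \<and> (X t \<omega> \<ge> g \<or> X t \<omega> \<le> h)}"

definition crossing_probability ::
    "'a measure \<Rightarrow> (real \<Rightarrow> 'a \<Rightarrow> real) \<Rightarrow> real \<Rightarrow> real \<Rightarrow> real \<Rightarrow> real" where
  "crossing_probability M X g h t =
     measure M {\<omega> \<in> space M. first_passage_time X g h \<omega> \<le> ennreal t}"

end

theory Submission
  imports Defs
begin

text \<open>
  A continuous local martingale with deterministic quadratic variation \<open>q\<close> has increments
  \<open>Z t - Z s\<close> that are independent of \<open>F s\<close> and normal with variance \<open>q t - q s\<close>, so it has the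
  finite-dimensional distributions of \<open>W \<circ> q\<close>. By continuity of the paths these determine the
  crossing probability, and \<open>W \<circ> q\<close> leaves \<open>(h, g)\<close> up to time \<open>t\<close> iff \<open>W\<close> leaves it up to
  time \<open>q t\<close>, since \<open>q\<close> maps \<open>[0, t]\<close> onto \<open>[0, q t]\<close>. No time change is needed.

  The law of the increments is obtained without stochastic integration. Take a fine grid of
  \<open>[s, t]\<close> and stop \<open>Z\<close> at the localizing times and as soon as it moves by \<open>\<epsilon>\<close> within a grid cell.
  The stopped increments \<open>y\<close> are bounded by \<open>\<epsilon>\<close>, so in the expansion of \<open>exp (i \<theta> y)\<close> to second
  order the martingale properties of \<open>Z\<close> and \<open>Z\<^sup>2 - q\<close> evaluate the main terms and the remainder
  sums to \<open>O(\<epsilon>)\<close>. The event that the stopping is active before \<open>t\<close> has small probability, so the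
  conditional characteristic function of \<open>Z t - Z s\<close> is \<open>exp (- \<theta>\<^sup>2 (q t - q s) / 2)\<close>.
\<close>

section \<open>Filtrations and martingales\<close>

text \<open>The grid argument needs one stopping time that turns both Z and Z^2 - q into martingales
  and also bounds the increments. The two localizing sequences are therefore merged with the
  oscillation time, which requires optional stopping for continuous martingales that are merely
  integrable. That q is deterministic enters through the factors exp (- \<theta>^2 d / 2): they are
  constants, leave the integrals, and give the same limit on every event of \<open>F s\<close>, so
  one computation yields law and independence together. Stopping makes the compensator of the
  stopped process random, but it differs from q only where the stopping is active, so the error is
  controlled by the probability of that event. The parameters are fixed in the order \<epsilon>,
  localization index, number of cells. Path properties hold only almost surely. Events about whole
  paths are therefore compared with events on a countable grid, and completeness moves them into the
  filtration. Flat pieces of q need separate care: a degenerate normal law has no density, and W is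
  described only at strictly increasing times.\<close>

definition clip :: "real \<Rightarrow> ennreal \<Rightarrow> real" where
  "clip t x = enn2real (min (ennreal t) x)"

lemma clip_nonneg: "0 \<le> clip t x"
  by (simp add: clip_def)

text \<open>\<open>enn2real\<close> sends \<infinity> to 0, but the minimum with a finite time is
  finite, so converting back loses nothing even where the stopping time is infinite.\<close>

lemma ennreal_clip: "ennreal (clip t x) = min (ennreal t) x"
  unfolding clip_def by (rule ennreal_enn2real) (rule le_less_trans[OF min.cobounded1], simp)

lemma clip_le: "0 \<le> t \<Longrightarrow> clip t x \<le> t"
  unfolding clip_def by (metis enn2real_ennreal enn2real_mono ennreal_less_top min.cobounded1)

lemma clip_eq_time: "0 \<le> t \<Longrightarrow> ennreal t \<le> x \<Longrightarrow> clip t x = t"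
  by (simp add: clip_def min_absorb1)

lemma clip_eq_clip: "0 \<le> u \<Longrightarrow> u \<le> t \<Longrightarrow> x \<le> ennreal u \<Longrightarrow> clip t x = clip u x"
  unfolding clip_def by (metis ennreal_leI min.absorb2 order_trans)

lemma clip_clip: "0 \<le> t \<Longrightarrow> clip (clip t x) y = clip t (min x y)"
  by (simp add: clip_def ennreal_clip[unfolded clip_def] min.assoc)

lemma clip_mono: "0 \<le> s \<Longrightarrow> s \<le> t \<Longrightarrow> clip s x \<le> clip t x"
  unfolding clip_def
  by (rule enn2real_mono) (auto intro: min.mono ennreal_leI min.coboundedI1 le_less_trans[OF min.cobounded1])

lemma stopped_process_eq: "stopped_process X \<tau> t \<omega> = X (clip t (\<tau> \<omega>)) \<omega>"
  by (simp add: stopped_process_def clip_def)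

lemma stopped_stopped_process:
  "0 \<le> t \<Longrightarrow> stopped_process (stopped_process X \<tau>) \<rho> t = stopped_process X (\<lambda>\<omega>. min (\<tau> \<omega>) (\<rho> \<omega>)) t"
  by (rule ext) (simp add: stopped_process_eq clip_clip min.commute)

section \<open>Null sets in the filtration and orthogonality of martingale increments\<close>

context stochastic_basis
begin

lemma space_F: "0 \<le> t \<Longrightarrow> space (F t) = space M"
  using subalgebra_F by (simp add: subalgebra_def)

lemma sets_F_subset: "0 \<le> t \<Longrightarrow> A \<in> sets (F t) \<Longrightarrow> A \<in> sets M"
  using subalgebra_F by (auto simp: subalgebra_def)

lemma measurable_F_M: "0 \<le> t \<Longrightarrow> f \<in> measurable (F t) N \<Longrightarrow> f \<in> measurable M N"
  using measurable_from_subalg[OF subalgebra_F] by blast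

lemma measurable_F_mono:
  "0 \<le> s \<Longrightarrow> s \<le> t \<Longrightarrow> f \<in> measurable (F s) N \<Longrightarrow> f \<in> measurable (F t) N"
  using F_mono[of s t] by (auto simp: measurable_def space_F)

text \<open>The two differences of A and B are null sets, which \<open>F t\<close> contains, so B
  arises from A by a correction inside \<open>F t\<close>. Completeness of M first makes B
  measurable at all. This is how events described by almost surely continuous paths enter the
  filtration.\<close>

lemma sets_F_AE_cong:
  assumes "0 \<le> t" "A \<in> sets (F t)" "B \<subseteq> space M" and ae: "AE \<omega> in M. \<omega> \<in> A \<longleftrightarrow> \<omega> \<in> B"
  shows "B \<in> sets (F t)"
proof -
  have A: "A \<in> sets M" using assms sets_F_subset by blast
  then have B: "B \<in> sets M"
    using in_sets_AE[OF ae] assms by blast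
  have null: "null_sets M \<subseteq> sets (F t)"
    using null_sets_F F_mono[of 0 t] assms by auto
  have "A - B \<in> null_sets M" "B - A \<in> null_sets M"
    unfolding null_sets_iff_AE using ae A B sets.sets_into_space by auto
  then have "A - B \<in> sets (F t)" "B - A \<in> sets (F t)"
    using null by auto
  then have "(A - (A - B)) \<union> (B - A) \<in> sets (F t)"
    using assms(2) by blast
  moreover have "(A - (A - B)) \<union> (B - A) = B" by auto
  ultimately show ?thesis by simp
qed

lemma borel_measurable_F_AE_cong:
  fixes f g :: "'a \<Rightarrow> 'b::topological_space"
  assumes "0 \<le> t" and f: "f \<in> borel_measurable (F t)" and ae: "AE \<omega> in M. f \<omega> = g \<omega>"
  shows "g \<in> borel_measurable (F t)"
proof (rule measurableI)
  fix S :: "'b set" assume "S \<in> sets borel"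
  then have "f -` S \<inter> space (F t) \<in> sets (F t)" using f by (rule measurable_sets[rotated])
  then show "g -` S \<inter> space (F t) \<in> sets (F t)"
  proof (rule sets_F_AE_cong[OF \<open>0 \<le> t\<close>])
    show "g -` S \<inter> space (F t) \<subseteq> space M" using space_F[OF \<open>0 \<le> t\<close>] by auto
    show "AE \<omega> in M. (\<omega> \<in> f -` S \<inter> space (F t)) = (\<omega> \<in> g -` S \<inter> space (F t))"
      using ae by eventually_elim auto
  qed
qed simp

text \<open>Integrability is asked of the product and not of the weight, so that the unbounded
  weight \<open>\<xi> \<omega> * Y s \<omega>\<close> in
  \<open>martingale_square_increment_orthogonal\<close> is covered.\<close>

lemma martingale_increment_orthogonal:
  assumes X: "martingale M F X" and st: "0 \<le> s" "s \<le> t"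
    and \<xi>: "\<xi> \<in> borel_measurable (F s)" "integrable M (\<lambda>\<omega>. \<xi> \<omega> * (X t \<omega> - X s \<omega>))"
  shows "(\<integral>\<omega>. \<xi> \<omega> * (X t \<omega> - X s \<omega>) \<partial>M) = 0"
proof -
  interpret S: finite_measure_subalgebra M "F s"
    by unfold_locales (rule subalgebra_F[OF st(1)])
  have int: "integrable M (X t)" "integrable M (X s)" and Xs: "X s \<in> borel_measurable (F s)"
    and ce: "AE \<omega> in M. real_cond_exp M (F s) (X t) \<omega> = X s \<omega>"
    using X st unfolding martingale_def adapted_process_def by auto
  have "AE \<omega> in M. real_cond_exp M (F s) (\<lambda>\<omega>. X t \<omega> - X s \<omega>) \<omega> = 0"
    using S.real_cond_exp_diff[OF int] S.real_cond_exp_F_meas[OF int(2) Xs] ce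
    by eventually_elim auto
  then have "(\<integral>\<omega>. \<xi> \<omega> * real_cond_exp M (F s) (\<lambda>\<omega>. X t \<omega> - X s \<omega>) \<omega> \<partial>M) = 0"
    by (intro integral_eq_zero_AE) auto
  moreover have "(\<lambda>\<omega>. X t \<omega> - X s \<omega>) \<in> borel_measurable M" using int by auto
  ultimately show ?thesis
    using S.real_cond_exp_intg(2)[OF \<xi>(2,1)] by simp
qed

lemma martingale_increment_orthogonal_bounded:
  assumes X: "martingale M F X" and st: "0 \<le> s" "s \<le> t"
    and \<xi>: "\<xi> \<in> borel_measurable (F s)" "\<And>\<omega>. \<bar>\<xi> \<omega>\<bar> \<le> C"
  shows "integrable M (\<lambda>\<omega>. \<xi> \<omega> * (X t \<omega> - X s \<omega>))"
    and "(\<integral>\<omega>. \<xi> \<omega> * (X t \<omega> - X s \<omega>) \<partial>M) = 0"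
proof -
  have int: "integrable M (\<lambda>\<omega>. X t \<omega> - X s \<omega>)"
    using X st unfolding martingale_def by auto
  have [measurable]: "\<xi> \<in> borel_measurable M" using \<xi>(1) st measurable_F_M by blast
  show *: "integrable M (\<lambda>\<omega>. \<xi> \<omega> * (X t \<omega> - X s \<omega>))"
    by (rule Bochner_Integration.integrable_bound[OF integrable_mult_right[OF int, of C]])
      (use int in \<open>auto simp: abs_mult intro!: mult_right_mono order.trans[OF \<xi>(2) abs_ge_self]\<close>)
  show "(\<integral>\<omega>. \<xi> \<omega> * (X t \<omega> - X s \<omega>) \<partial>M) = 0"
    by (rule martingale_increment_orthogonal[OF X st \<xi>(1) *])
qed

lemma martingaleI:
  assumes ad: "\<And>t. 0 \<le> t \<Longrightarrow> X t \<in> borel_measurable (F t)"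
    and int: "\<And>t. 0 \<le> t \<Longrightarrow> integrable M (X t)"
    and eq: "\<And>s t A. 0 \<le> s \<Longrightarrow> s \<le> t \<Longrightarrow> A \<in> sets (F s) \<Longrightarrow>
      (\<integral>\<omega>. indicator A \<omega> * X t \<omega> \<partial>M) = (\<integral>\<omega>. indicator A \<omega> * X s \<omega> \<partial>M)"
  shows "martingale M F X"
  unfolding martingale_def adapted_process_def
proof (intro conjI allI impI)
  fix s t :: real assume st: "0 \<le> s" "s \<le> t"
  interpret S: finite_measure_subalgebra M "F s"
    by unfold_locales (rule subalgebra_F[OF st(1)])
  show "AE \<omega> in M. real_cond_exp M (F s) (X t) \<omega> = X s \<omega>"
    by (rule S.real_cond_exp_charact)
      (use eq[OF st] int ad st in \<open>auto simp: set_lebesgue_integral_def\<close>)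
qed (use ad int in auto)

end

section \<open>Convexity and uniform integrability\<close>

lemma excess_subgradient:
  fixes x y K :: real
  assumes "0 \<le> K"
  shows "max (\<bar>x\<bar> - K) 0 + (if \<bar>x\<bar> > K then sgn x else 0) * (y - x) \<le> max (\<bar>y\<bar> - K) 0"
  using assms by (auto simp: max_def sgn_if abs_if split: if_splits)

text \<open>Cutting x off at the levels K and -K removes exactly the excess
  \<open>max (\<bar>x\<bar> - K) 0\<close>, so this is a triangle inequality.\<close>

lemma truncation_distance:
  fixes x y K :: real
  assumes "0 \<le> K"
  shows "\<bar>x - y\<bar> \<le> \<bar>max (- K) (min x K) - max (- K) (min y K)\<bar> + (max (\<bar>x\<bar> - K) 0 + max (\<bar>y\<bar> - K) 0)"
  using assms by (auto simp: max_def min_def abs_if)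

lemma excess_integral_tendsto_0:
  fixes f :: "'a \<Rightarrow> real"
  assumes f: "integrable M f"
  shows "(\<lambda>n. \<integral>x. max (\<bar>f x\<bar> - real n) 0 \<partial>M) \<longlonglongrightarrow> 0"
proof -
  have "(\<lambda>n. \<integral>x. max (\<bar>f x\<bar> - real n) 0 \<partial>M) \<longlonglongrightarrow> (\<integral>x. 0 \<partial>M)"
  proof (rule integral_dominated_convergence[where w="\<lambda>x. \<bar>f x\<bar>"])
    show "AE x in M. (\<lambda>n. max (\<bar>f x\<bar> - real n) 0) \<longlonglongrightarrow> 0"
    proof (rule AE_I2)
      fix x
      obtain n0 :: nat where "\<bar>f x\<bar> \<le> real n0" using real_arch_simple by blast
      have "eventually (\<lambda>n. max (\<bar>f x\<bar> - real n) 0 = 0) sequentially"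
        using eventually_ge_at_top[of n0] by eventually_elim (use \<open>\<bar>f x\<bar> \<le> real n0\<close> in auto)
      then show "(\<lambda>n. max (\<bar>f x\<bar> - real n) 0) \<longlonglongrightarrow> 0" by (rule tendsto_eventually)
    qed
  qed (use f in auto)
  then show ?thesis by simp
qed

text \<open>Convergence of integrals under uniform integrability; the latter is expressed by the
  domination of the excess integrals, which is what convexity yields for stopped martingales.\<close>

lemma (in finite_measure) excess_dominated_convergence:
  fixes S :: "nat \<Rightarrow> 'a \<Rightarrow> real" and L Y :: "'a \<Rightarrow> real"
  assumes S: "\<And>k. integrable M (S k)" and L[measurable]: "L \<in> borel_measurable M" and Y: "integrable M Y"
    and lim: "AE x in M. (\<lambda>k. S k x) \<longlonglongrightarrow> L x"
    and dom: "\<And>k n. (\<integral>x. max (\<bar>S k x\<bar> - real n) 0 \<partial>M) \<le> (\<integral>x. max (\<bar>Y x\<bar> - real n) 0 \<partial>M)"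
  shows "integrable M L" and "(\<lambda>k. \<integral>x. \<bar>S k x - L x\<bar> \<partial>M) \<longlonglongrightarrow> 0"
proof -
  have [measurable]: "S k \<in> borel_measurable M" for k using S by auto
  show intL: "integrable M L"
  proof (rule integrableI_bounded)
    have "(\<integral>\<^sup>+x. ennreal (norm (L x)) \<partial>M) = (\<integral>\<^sup>+x. liminf (\<lambda>k. ennreal \<bar>S k x\<bar>) \<partial>M)"
    proof (rule nn_integral_cong_AE)
      show "AE x in M. ennreal (norm (L x)) = liminf (\<lambda>k. ennreal \<bar>S k x\<bar>)"
        using lim
      proof eventually_elim
        fix x assume "(\<lambda>k. S k x) \<longlonglongrightarrow> L x"
        then have "(\<lambda>k. ennreal \<bar>S k x\<bar>) \<longlonglongrightarrow> ennreal \<bar>L x\<bar>" by (intro tendsto_intros)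
        then show "ennreal (norm (L x)) = liminf (\<lambda>k. ennreal \<bar>S k x\<bar>)"
          using lim_imp_Liminf[of sequentially] by force
      qed
    qed
    \<comment> \<open>Fatou's lemma; the domination hypothesis at level 0 then bounds all first
      moments by that of Y.\<close>
    also have "\<dots> \<le> liminf (\<lambda>k. \<integral>\<^sup>+x. ennreal \<bar>S k x\<bar> \<partial>M)"
      by (rule nn_integral_liminf) simp
    also have "\<dots> \<le> ennreal (\<integral>x. \<bar>Y x\<bar> \<partial>M)"
    proof (rule Liminf_le)
      show "\<forall>\<^sub>F k in sequentially. (\<integral>\<^sup>+x. ennreal \<bar>S k x\<bar> \<partial>M) \<le> ennreal (\<integral>x. \<bar>Y x\<bar> \<partial>M)"
        using dom[of _ 0] S by (auto simp: nn_integral_eq_integral ennreal_leI)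
    qed simp
    finally show "(\<integral>\<^sup>+x. ennreal (norm (L x)) \<partial>M) < \<infinity>"
      by (simp add: le_less_trans)
  qed simp
  show "(\<lambda>k. \<integral>x. \<bar>S k x - L x\<bar> \<partial>M) \<longlonglongrightarrow> 0"
  proof (rule LIMSEQ_I)
    fix r :: real assume r: "0 < r"
    \<comment> \<open>At a suitable level the excesses of L and Y each cost less than r/3, and the
      excess of \<open>S k\<close> costs no more than that of Y. The last third is left for the
      truncations, which converge boundedly.\<close>
    have "eventually (\<lambda>n. (\<integral>x. max (\<bar>L x\<bar> - real n) 0 \<partial>M) < r/3) sequentially"
      "eventually (\<lambda>n. (\<integral>x. max (\<bar>Y x\<bar> - real n) 0 \<partial>M) < r/3) sequentially"
      using order_tendstoD(2)[OF excess_integral_tendsto_0[OF intL], of "r/3"]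
        order_tendstoD(2)[OF excess_integral_tendsto_0[OF Y], of "r/3"] r by auto
    then have "eventually (\<lambda>n. (\<integral>x. max (\<bar>L x\<bar> - real n) 0 \<partial>M) < r/3 \<and>
      (\<integral>x. max (\<bar>Y x\<bar> - real n) 0 \<partial>M) < r/3) sequentially" by eventually_elim simp
    then obtain n :: nat where n: "(\<integral>x. max (\<bar>L x\<bar> - real n) 0 \<partial>M) < r/3" "(\<integral>x. max (\<bar>Y x\<bar> - real n) 0 \<partial>M) < r/3"
      by (auto dest: eventually_happens)
    define c where "c y = max (- real n) (min y (real n))" for y :: real
    have [measurable]: "c \<in> borel_measurable borel" unfolding c_def by measurable
    have cont: "isCont c y" for y unfolding c_def by (intro continuous_intros)
    have "(\<lambda>k. \<integral>x. \<bar>c (S k x) - c (L x)\<bar> \<partial>M) \<longlonglongrightarrow> (\<integral>x. 0 \<partial>M)"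
    proof (rule integral_dominated_convergence[where w="\<lambda>_. 2 * real n"])
      show "AE x in M. (\<lambda>k. \<bar>c (S k x) - c (L x)\<bar>) \<longlonglongrightarrow> 0"
        using lim
      proof eventually_elim
        fix x assume "(\<lambda>k. S k x) \<longlonglongrightarrow> L x"
        then have "(\<lambda>k. c (S k x)) \<longlonglongrightarrow> c (L x)" using isCont_tendsto_compose[OF cont] by blast
        then show "(\<lambda>k. \<bar>c (S k x) - c (L x)\<bar>) \<longlonglongrightarrow> 0"
          by (intro tendsto_rabs_zero) (simp add: LIM_zero)
      qed
      show "AE x in M. norm \<bar>c (S k x) - c (L x)\<bar> \<le> 2 * real n" for k
        by (rule AE_I2) (auto simp: c_def)
    qed auto
    then have "eventually (\<lambda>k. (\<integral>x. \<bar>c (S k x) - c (L x)\<bar> \<partial>M) < r/3) sequentially"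
      using r by (intro order_tendstoD(2)) auto
    then obtain k0 where k0: "\<And>k. k \<ge> k0 \<Longrightarrow> (\<integral>x. \<bar>c (S k x) - c (L x)\<bar> \<partial>M) < r/3"
      by (auto simp: eventually_sequentially)
    show "\<exists>k0. \<forall>k\<ge>k0. norm ((\<integral>x. \<bar>S k x - L x\<bar> \<partial>M) - 0) < r"
    proof (intro exI allI impI)
      fix k assume "k0 \<le> k"
      have i: "integrable M (\<lambda>x. \<bar>c (S k x) - c (L x)\<bar>)"
        by (rule integrable_const_bound[where B="2 * real n"]) (auto simp: c_def)
      have ex: "integrable M (\<lambda>x. max (\<bar>f x\<bar> - real n) 0)" if "integrable M f" for f :: "'a \<Rightarrow> real"
        using that by auto
      have "(\<integral>x. \<bar>S k x - L x\<bar> \<partial>M) \<le> (\<integral>x. \<bar>c (S k x) - c (L x)\<bar> + (max (\<bar>S k x\<bar> - real n) 0 + max (\<bar>L x\<bar> - real n) 0) \<partial>M)"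
        by (rule integral_mono) (use S intL i truncation_distance in \<open>auto simp: c_def\<close>)
      also have "\<dots> = (\<integral>x. \<bar>c (S k x) - c (L x)\<bar> \<partial>M) + ((\<integral>x. max (\<bar>S k x\<bar> - real n) 0 \<partial>M) + (\<integral>x. max (\<bar>L x\<bar> - real n) 0 \<partial>M))"
        using i ex[OF S[of k]] ex[OF intL] by simp
      also have "\<dots> < r" using k0[OF \<open>k0 \<le> k\<close>] n dom[of k n] by linarith
      finally show "norm ((\<integral>x. \<bar>S k x - L x\<bar> \<partial>M) - 0) < r" by simp
    qed
  qed
qed

section \<open>Optional stopping for continuous martingales\<close>

context stochastic_basis
begin

lemma extended_stopping_timeD:
  assumes "extended_stopping_time F \<tau>" "0 \<le> u"
  shows "{\<omega>\<in>space M. \<tau> \<omega> \<le> ennreal u} \<in> sets (F u)" "{\<omega>\<in>space M. ennreal u < \<tau> \<omega>} \<in> sets (F u)"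
proof -
  have p: "Measurable.pred (F u) (\<lambda>\<omega>. \<tau> \<omega> \<le> ennreal u)"
    using assms by (simp add: extended_stopping_time_def)
  have "Measurable.pred (F u) (\<lambda>\<omega>. ennreal u < \<tau> \<omega>)"
    using pred_intros_logic(2)[OF p] by (simp add: not_le)
  from p this show "{\<omega>\<in>space M. \<tau> \<omega> \<le> ennreal u} \<in> sets (F u)" "{\<omega>\<in>space M. ennreal u < \<tau> \<omega>} \<in> sets (F u)"
    using space_F[OF assms(2)] by (auto simp: pred_def)
qed

text \<open>X is stopped at the grid points of [s, t] instead of at \<tau>; there the claim is a
  finite sum of orthogonality relations. Continuity of the paths gives convergence to L as the grid
  is refined, and domination of the excess integrals by those of \<open>X t\<close> carries the
  integrals along. Stopping never happens before s, so that events of \<open>F s\<close> may be used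
  as weights.\<close>

lemma optional_stopping_from:
  assumes X: "martingale M F X" and cont: "continuous_process M X"
    and \<tau>: "extended_stopping_time F \<tau>" and st: "0 \<le> s" "s \<le> t"
  defines "L \<equiv> \<lambda>\<omega>. X (max s (clip t (\<tau> \<omega>))) \<omega>"
  shows "L \<in> borel_measurable (F t)" and "integrable M L"
    and "A \<in> sets (F s) \<Longrightarrow> (\<integral>\<omega>. indicator A \<omega> * L \<omega> \<partial>M) = (\<integral>\<omega>. indicator A \<omega> * X s \<omega> \<partial>M)"
proof -
  define u where "u k j = s + (t - s) * real j / real (Suc k)" for k j :: nat
  define H where "H k j = {\<omega>\<in>space M. ennreal (u k j) < \<tau> \<omega>}" for k j
  \<comment> \<open>Summing the increments with weights \<open>H k j\<close> gives X stopped at the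
    first grid point not before \<tau>. These weights are known at time \<open>u k j\<close>, so
    every summand has integral 0 over events of \<open>F s\<close>.\<close>
  define S where "S k i \<omega> = X s \<omega> + (\<Sum>j<i. indicator (H k j) \<omega> * (X (u k (Suc j)) \<omega> - X (u k j) \<omega>))" for k i \<omega>
  have u0: "u k 0 = s" and uk: "u k (Suc k) = t" for k by (simp_all add: u_def)
  have u_mono: "u k i \<le> u k j" if "i \<le> j" for k i j
    unfolding u_def using st that by (auto intro!: divide_right_mono mult_left_mono)
  have u_ge: "s \<le> u k j" for k j using u_mono[of 0 j k] by (simp add: u0)
  have u_ge0: "0 \<le> u k j" for k j using u_ge[of k j] st by linarith
  have u_le: "u k j \<le> t" if "j \<le> Suc k" for k j using u_mono[OF that, of k] by (simp only: uk)
  have u_step: "u k (Suc j) = u k j + (t - s) / real (Suc k)" for k j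
    by (simp add: u_def field_simps del: of_nat_Suc) (simp add: field_simps)
  have int: "integrable M (X v)" and meas: "X v \<in> borel_measurable (F v)" if "0 \<le> v" for v
    using X that unfolding martingale_def adapted_process_def by auto
  have H: "H k j \<in> sets (F (u k j))" for k j
    unfolding H_def by (rule extended_stopping_timeD(2)[OF \<tau> u_ge0])
  have H': "H k j \<in> sets M" for k j using H sets_F_subset u_ge0 by blast
  have S_meas: "S k i \<in> borel_measurable (F (u k i))" for k i
  proof -
    have a: "X v \<in> borel_measurable (F (u k i))" if "0 \<le> v" "v \<le> u k i" for v
      using meas[OF that(1)] measurable_F_mono that by blast
    have b: "H k j \<in> sets (F (u k i))" if "j < i" for j
      using H[of k j] F_mono[OF u_ge0 u_mono, of j i k] that by auto
    show ?thesis unfolding S_def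
      by (intro borel_measurable_add borel_measurable_sum borel_measurable_times borel_measurable_diff
          borel_measurable_indicator a b) (use st u_ge u_ge0 u_mono in \<open>auto simp: Suc_le_eq\<close>)
  qed
  have S_int: "integrable M (S k i)" for k i
    unfolding S_def
  proof (intro Bochner_Integration.integrable_add Bochner_Integration.integrable_sum int st)
    fix j
    have "integrable M (\<lambda>\<omega>. X (u k (Suc j)) \<omega> - X (u k j) \<omega>)" using int u_ge0 by auto
    then show "integrable M (\<lambda>\<omega>. indicator (H k j) \<omega> * (X (u k (Suc j)) \<omega> - X (u k j) \<omega>))"
      using integrable_mult_indicator[OF H'[of k j]] by fastforce
  qed
  have S_eq: "(\<integral>\<omega>. indicator A \<omega> * S k i \<omega> \<partial>M) = (\<integral>\<omega>. indicator A \<omega> * X s \<omega> \<partial>M)"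
    if A: "A \<in> sets (F s)" for A k i
  proof -
    have AM: "A \<in> sets M" using A sets_F_subset st by blast
    let ?\<xi> = "\<lambda>j \<omega>. indicator A \<omega> * indicator (H k j) \<omega> :: real"
    have \<xi>: "?\<xi> j \<in> borel_measurable (F (u k j))" for j
    proof -
      have "A \<in> sets (F (u k j))" using A F_mono[OF st(1) u_ge] by blast
      then show ?thesis using H[of k j] by measurable
    qed
    have b: "\<bar>?\<xi> j \<omega>\<bar> \<le> 1" for j \<omega> by (auto simp: indicator_def)
    note orth = martingale_increment_orthogonal_bounded[OF X u_ge0 u_mono \<xi> b, of _ "Suc _"]
    have "(\<integral>\<omega>. indicator A \<omega> * S k i \<omega> \<partial>M) =
      (\<integral>\<omega>. indicator A \<omega> * X s \<omega> + (\<Sum>j<i. ?\<xi> j \<omega> * (X (u k (Suc j)) \<omega> - X (u k j) \<omega>)) \<partial>M)"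
      by (simp only: S_def distrib_left sum_distrib_left mult.assoc)
    also have "\<dots> = (\<integral>\<omega>. indicator A \<omega> * X s \<omega> \<partial>M) +
        (\<Sum>j<i. \<integral>\<omega>. ?\<xi> j \<omega> * (X (u k (Suc j)) \<omega> - X (u k j) \<omega>) \<partial>M)"
      using integrable_mult_indicator[OF AM int[OF st(1)]] orth(1)
      by (subst Bochner_Integration.integral_add) (auto simp: integral_sum)
    also have "\<dots> = (\<integral>\<omega>. indicator A \<omega> * X s \<omega> \<partial>M)"
      using orth(2) by simp
    finally show ?thesis .
  qed
  \<comment> \<open>Jensen's inequality by hand: \<open>excess_subgradient\<close> is applied with
    the stopped value as x and \<open>X t\<close> as y, and its linear term integrates to 0. That
    term is a sum of the increments after stopping, weighted by the subgradient g at the stopped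
    value.\<close>
  have S_dom: "(\<integral>\<omega>. max (\<bar>S k (Suc k) \<omega>\<bar> - real n) 0 \<partial>M) \<le> (\<integral>\<omega>. max (\<bar>X t \<omega>\<bar> - real n) 0 \<partial>M)" for k n
  proof -
    define g where "g x = (if \<bar>x\<bar> > real n then sgn x else 0)" for x :: real
    have [measurable]: "g \<in> borel_measurable borel" unfolding g_def by measurable
    let ?\<xi> = "\<lambda>j \<omega>. g (S k j \<omega>) * (1 - indicator (H k j) \<omega>)"
    have \<xi>: "?\<xi> j \<in> borel_measurable (F (u k j))" for j
      using S_meas[of k j] H[of k j] by measurable
    have b: "\<bar>?\<xi> j \<omega>\<bar> \<le> 1" for j \<omega> by (auto simp: indicator_def g_def sgn_if)
    note orth = martingale_increment_orthogonal_bounded[OF X u_ge0 u_mono \<xi> b, of _ "Suc _"]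
    \<comment> \<open>Off \<open>H k j\<close> the sum is already frozen at step j, so g of the
      final value is there g of \<open>S k j\<close>, which is known at time
      \<open>u k j\<close>.\<close>
    have stop: "S k i \<omega> = S k j \<omega>" if "\<omega> \<notin> H k j" "j \<le> i" "\<omega> \<in> space M" for i j \<omega>
      using that(2)
    proof (induction i rule: dec_induct)
      case (step i)
      have "\<omega> \<notin> H k i"
        using that ennreal_leI[OF u_mono[OF step(1), of k]] by (auto simp: H_def)
      then show ?case using step by (simp add: S_def)
    qed simp
    have tele: "g (S k (Suc k) \<omega>) * (X t \<omega> - S k (Suc k) \<omega>) =
      (\<Sum>j<Suc k. ?\<xi> j \<omega> * (X (u k (Suc j)) \<omega> - X (u k j) \<omega>))" if "\<omega> \<in> space M" for \<omega>
    proof -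
      have "X t \<omega> - X s \<omega> = (\<Sum>j<Suc k. X (u k (Suc j)) \<omega> - X (u k j) \<omega>)"
        using sum_lessThan_telescope[of "\<lambda>j. X (u k j) \<omega>" "Suc k"] by (simp only: u0 uk)
      then have "X t \<omega> - S k (Suc k) \<omega> =
        (\<Sum>j<Suc k. (1 - indicator (H k j) \<omega>) * (X (u k (Suc j)) \<omega> - X (u k j) \<omega>))"
        unfolding S_def by (simp add: left_diff_distrib sum_subtractf del: sum.lessThan_Suc)
      then show ?thesis
        using stop[of \<omega> _ "Suc k"] that
        by (auto simp: sum_distrib_left indicator_def simp del: sum.lessThan_Suc intro!: sum.cong)
    qed
    have zero: "(\<integral>\<omega>. g (S k (Suc k) \<omega>) * (X t \<omega> - S k (Suc k) \<omega>) \<partial>M) = 0"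
      and zint: "integrable M (\<lambda>\<omega>. g (S k (Suc k) \<omega>) * (X t \<omega> - S k (Suc k) \<omega>))"
      using orth by (auto simp: tele integral_sum simp del: sum.lessThan_Suc cong: Bochner_Integration.integral_cong Bochner_Integration.integrable_cong)
    have "(\<integral>\<omega>. max (\<bar>S k (Suc k) \<omega>\<bar> - real n) 0 \<partial>M) =
      (\<integral>\<omega>. max (\<bar>S k (Suc k) \<omega>\<bar> - real n) 0 + g (S k (Suc k) \<omega>) * (X t \<omega> - S k (Suc k) \<omega>) \<partial>M)"
      using zero zint S_int[of k "Suc k"] by (subst Bochner_Integration.integral_add) auto
    also have "\<dots> \<le> (\<integral>\<omega>. max (\<bar>X t \<omega>\<bar> - real n) 0 \<partial>M)"
      using zint S_int[of k "Suc k"] int[of t] st excess_subgradient[of "real n"]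
      by (intro integral_mono) (auto simp: g_def)
    finally show ?thesis .
  qed
  \<comment> \<open>The discrete stopping overshoots the true stopping time by at most one cell, so
    the witness v converges to it.\<close>
  have near: "\<exists>v. s \<le> v \<and> v \<le> u k i \<and> S k i \<omega> = X v \<omega> \<and> max s (clip (u k i) (\<tau> \<omega>)) \<le> v \<and>
      v \<le> max s (clip (u k i) (\<tau> \<omega>)) + (t - s) / real (Suc k)" if "\<omega> \<in> space M" for k i \<omega>
  proof (induction i)
    case 0
    show ?case using st clip_le[OF st(1), of "\<tau> \<omega>"] by (intro exI[of _ s]) (auto simp: u0 S_def)
  next
    case (Suc i)
    then obtain v where v: "s \<le> v" "v \<le> u k i" "S k i \<omega> = X v \<omega>" "max s (clip (u k i) (\<tau> \<omega>)) \<le> v"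
      "v \<le> max s (clip (u k i) (\<tau> \<omega>)) + (t - s) / real (Suc k)" by blast
    show ?case
    proof (cases "ennreal (u k i) < \<tau> \<omega>")
      case True
      then have c: "clip (u k i) (\<tau> \<omega>) = u k i" by (intro clip_eq_time u_ge0) auto
      then have "v = u k i" using v by auto
      then have "S k (Suc i) \<omega> = X (u k (Suc i)) \<omega>"
        using v(3) True that unfolding S_def by (simp add: H_def)
      moreover have "u k i \<le> clip (u k (Suc i)) (\<tau> \<omega>)"
        using clip_mono[OF u_ge0 u_mono, of i "Suc i" k "\<tau> \<omega>"] c by simp
      ultimately show ?thesis
        using u_ge[of k "Suc i"] clip_le[OF u_ge0, of k "Suc i" "\<tau> \<omega>"] u_step[of k i]
        by (intro exI[of _ "u k (Suc i)"]) auto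
    next
      case False
      then have "clip (u k (Suc i)) (\<tau> \<omega>) = clip (u k i) (\<tau> \<omega>)"
        by (intro clip_eq_clip u_ge0 u_mono) auto
      moreover have "S k (Suc i) \<omega> = S k i \<omega>" using False by (simp add: S_def H_def)
      ultimately show ?thesis
        using v u_mono[of i "Suc i" k] by (intro exI[of _ v]) auto
    qed
  qed
  have lim: "AE \<omega> in M. (\<lambda>k. S k (Suc k) \<omega>) \<longlonglongrightarrow> L \<omega>"
    using cont[unfolded continuous_process_def] AE_space
  proof eventually_elim
    fix \<omega> assume c: "continuous_on {0..} (\<lambda>t. X t \<omega>)" and \<omega>: "\<omega> \<in> space M"
    define m where "m = max s (clip t (\<tau> \<omega>))"
    have "\<forall>k. \<exists>v. s \<le> v \<and> S k (Suc k) \<omega> = X v \<omega> \<and> m \<le> v \<and> v \<le> m + (t - s) / real (Suc k)"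
    proof
      fix k
      show "\<exists>v. s \<le> v \<and> S k (Suc k) \<omega> = X v \<omega> \<and> m \<le> v \<and> v \<le> m + (t - s) / real (Suc k)"
        using near[OF \<omega>, of k "Suc k"] unfolding uk m_def by blast
    qed
    then obtain v where v: "\<And>k. s \<le> v k" "\<And>k. S k (Suc k) \<omega> = X (v k) \<omega>" "\<And>k. m \<le> v k"
      "\<And>k. v k \<le> m + (t - s) / real (Suc k)" by metis
    have "v \<longlonglongrightarrow> m"
    proof (rule tendsto_sandwich[OF _ _ tendsto_const])
      have "(\<lambda>k. m + (t - s) * inverse (real (Suc k))) \<longlonglongrightarrow> m + (t - s) * 0"
        by (intro tendsto_intros LIMSEQ_inverse_real_of_nat)
      then show "(\<lambda>k. m + (t - s) / real (Suc k)) \<longlonglongrightarrow> m" by (simp add: divide_inverse)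
    qed (use v in auto)
    then have "(\<lambda>k. X (v k) \<omega>) \<longlonglongrightarrow> X m \<omega>"
      by (rule continuous_on_tendsto_compose[OF c]) (use order.trans[OF st(1) v(1)] st in \<open>auto simp: m_def\<close>)
    then show "(\<lambda>k. S k (Suc k) \<omega>) \<longlonglongrightarrow> L \<omega>" by (simp add: v(2) L_def m_def)
  qed
  have t0: "0 \<le> t" using st by simp
  have SFt: "S k (Suc k) \<in> borel_measurable (F t)" for k using S_meas[of k "Suc k"] unfolding uk .
  \<comment> \<open>L is only an almost sure limit of functions measurable for \<open>F t\<close>;
    completeness makes it measurable itself.\<close>
  show LF: "L \<in> borel_measurable (F t)"
  proof (rule borel_measurable_F_AE_cong[OF t0])
    show "(\<lambda>\<omega>. lim (\<lambda>k. S k (Suc k) \<omega>)) \<in> borel_measurable (F t)"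
      using SFt by (rule borel_measurable_lim_metric)
    show "AE \<omega> in M. lim (\<lambda>k. S k (Suc k) \<omega>) = L \<omega>"
      using lim by eventually_elim (rule limI)
  qed
  have LM[measurable]: "L \<in> borel_measurable M" using LF measurable_F_M[OF t0] by blast
  note * = excess_dominated_convergence[OF S_int LM int[OF t0] lim S_dom]
  show intL: "integrable M L" by (rule *(1))
  assume A: "A \<in> sets (F s)"
  have AM[measurable]: "A \<in> sets M" using A sets_F_subset st by blast
  have "(\<lambda>k. (\<integral>\<omega>. indicator A \<omega> * S k (Suc k) \<omega> \<partial>M) - (\<integral>\<omega>. indicator A \<omega> * L \<omega> \<partial>M)) \<longlonglongrightarrow> 0"
  proof (rule Lim_null_comparison[OF _ *(2)], intro always_eventually allI)
    fix k
    have i: "integrable M (\<lambda>\<omega>. indicator A \<omega> * S k (Suc k) \<omega>)" "integrable M (\<lambda>\<omega>. indicator A \<omega> * L \<omega>)"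
      using integrable_mult_indicator[OF AM S_int[of k "Suc k"]] integrable_mult_indicator[OF AM intL] by auto
    have "norm ((\<integral>\<omega>. indicator A \<omega> * S k (Suc k) \<omega> \<partial>M) - (\<integral>\<omega>. indicator A \<omega> * L \<omega> \<partial>M)) =
        norm (\<integral>\<omega>. indicator A \<omega> * S k (Suc k) \<omega> - indicator A \<omega> * L \<omega> \<partial>M)"
      using i by simp
    also have "\<dots> \<le> (\<integral>\<omega>. norm (indicator A \<omega> * S k (Suc k) \<omega> - indicator A \<omega> * L \<omega>) \<partial>M)"
      by (rule integral_norm_bound)
    also have "\<dots> \<le> (\<integral>\<omega>. \<bar>S k (Suc k) \<omega> - L \<omega>\<bar> \<partial>M)"
      by (rule integral_mono) (use i S_int intL in \<open>auto simp: indicator_def\<close>)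
    finally show "norm ((\<integral>\<omega>. indicator A \<omega> * S k (Suc k) \<omega> \<partial>M) - (\<integral>\<omega>. indicator A \<omega> * L \<omega> \<partial>M)) \<le> (\<integral>\<omega>. \<bar>S k (Suc k) \<omega> - L \<omega>\<bar> \<partial>M)" .
  qed
  then show "(\<integral>\<omega>. indicator A \<omega> * L \<omega> \<partial>M) = (\<integral>\<omega>. indicator A \<omega> * X s \<omega> \<partial>M)"
    by (simp add: S_eq[OF A] LIMSEQ_const_iff)
qed

text \<open>On the part of A where \<tau> \<le> s the stopped process no longer moves after s. On
  the rest the stopped time is at least s, so the maximum in \<open>optional_stopping_from\<close>
  does nothing and that lemma applies to an event of \<open>F s\<close>.\<close>

theorem martingale_stopped:
  assumes X: "martingale M F X" and cont: "continuous_process M X" and \<tau>: "extended_stopping_time F \<tau>"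
  shows "martingale M F (stopped_process X \<tau>)"
proof (rule martingaleI)
  have stop0: "stopped_process X \<tau> t = (\<lambda>\<omega>. X (max 0 (clip t (\<tau> \<omega>))) \<omega>)" for t
    by (rule ext) (simp add: stopped_process_eq max_absorb2 clip_nonneg)
  show meas: "stopped_process X \<tau> t \<in> borel_measurable (F t)"
    and int: "integrable M (stopped_process X \<tau> t)" if "0 \<le> t" for t
    unfolding stop0 using optional_stopping_from[OF X cont \<tau> order_refl that] by auto
  fix s t :: real and A assume st: "0 \<le> s" "s \<le> t" and A: "A \<in> sets (F s)"
  then have t0: "0 \<le> t" by simp
  let ?E = "A \<inter> {\<omega>\<in>space M. \<tau> \<omega> \<le> ennreal s}" and ?D = "A \<inter> {\<omega>\<in>space M. ennreal s < \<tau> \<omega>}"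
  let ?L = "\<lambda>\<omega>. X (max s (clip t (\<tau> \<omega>))) \<omega>"
  have E: "?E \<in> sets (F s)" and D: "?D \<in> sets (F s)"
    using A extended_stopping_timeD[OF \<tau> st(1)] by auto
  have EM: "?E \<in> sets M" and DM: "?D \<in> sets M" using E D sets_F_subset st(1) by blast+
  note L = optional_stopping_from[OF X cont \<tau> st]
  have Xs: "integrable M (X s)" using X st by (auto simp: martingale_def)
  have "(\<integral>\<omega>. indicator A \<omega> * stopped_process X \<tau> t \<omega> \<partial>M) =
     (\<integral>\<omega>. indicator ?E \<omega> * stopped_process X \<tau> s \<omega> + indicator ?D \<omega> * ?L \<omega> \<partial>M)"
  proof (rule Bochner_Integration.integral_cong[OF refl])
    fix \<omega> assume "\<omega> \<in> space M"
    show "indicator A \<omega> * stopped_process X \<tau> t \<omega> =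
      indicator ?E \<omega> * stopped_process X \<tau> s \<omega> + indicator ?D \<omega> * ?L \<omega>"
    proof (cases "\<tau> \<omega> \<le> ennreal s")
      case True
      then show ?thesis using \<open>\<omega> \<in> space M\<close> st
        by (simp add: stopped_process_eq clip_eq_clip[of s t] indicator_def not_less)
    next
      case False
      then have "s \<le> clip t (\<tau> \<omega>)"
        using clip_mono[OF st, of "\<tau> \<omega>"] clip_eq_time[OF st(1), of "\<tau> \<omega>"] by simp
      then show ?thesis using False \<open>\<omega> \<in> space M\<close>
        by (simp add: stopped_process_eq indicator_def max_absorb2 not_le)
    qed
  qed
  also have "\<dots> = (\<integral>\<omega>. indicator ?E \<omega> * stopped_process X \<tau> s \<omega> \<partial>M) + (\<integral>\<omega>. indicator ?D \<omega> * ?L \<omega> \<partial>M)"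
    using integrable_mult_indicator[OF EM int[OF st(1)]] integrable_mult_indicator[OF DM L(2)]
    by (intro Bochner_Integration.integral_add) auto
  also have "(\<integral>\<omega>. indicator ?D \<omega> * ?L \<omega> \<partial>M) = (\<integral>\<omega>. indicator ?D \<omega> * X s \<omega> \<partial>M)"
    by (rule L(3)[OF D])
  also have "(\<integral>\<omega>. indicator ?E \<omega> * stopped_process X \<tau> s \<omega> \<partial>M) + \<dots> =
    (\<integral>\<omega>. indicator ?E \<omega> * stopped_process X \<tau> s \<omega> + indicator ?D \<omega> * X s \<omega> \<partial>M)"
    using integrable_mult_indicator[OF EM int[OF st(1)]] integrable_mult_indicator[OF DM Xs]
    by (intro Bochner_Integration.integral_add[symmetric]) auto
  also have "\<dots> = (\<integral>\<omega>. indicator A \<omega> * stopped_process X \<tau> s \<omega> \<partial>M)"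
    by (rule Bochner_Integration.integral_cong[OF refl])
      (use st in \<open>auto simp: stopped_process_eq indicator_def clip_eq_time\<close>)
  finally show "(\<integral>\<omega>. indicator A \<omega> * stopped_process X \<tau> t \<omega> \<partial>M) =
    (\<integral>\<omega>. indicator A \<omega> * stopped_process X \<tau> s \<omega> \<partial>M)" .
qed

end

section \<open>One step of the characteristic function\<close>

text \<open>For the upper bound, exp a is bounded below by its quadratic Taylor polynomial; the
  reciprocal is at most 1 - a + a^2 / 2 because the product of the two polynomials is 1 + a^4 /
  4.\<close>

lemma exp_minus_quadratic_bound:
  fixes a :: real
  assumes "0 \<le> a"
  shows "\<bar>exp (- a) - 1 + a\<bar> \<le> a\<^sup>2 / 2"
proof -
  have "1 + a + a\<^sup>2 / 2 \<le> exp a" by (rule exp_lower_Taylor_quadratic[OF assms])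
  moreover have pos: "0 < 1 + a + a\<^sup>2 / 2" using assms by (simp add: add_pos_nonneg)
  ultimately have "exp (- a) \<le> 1 / (1 + a + a\<^sup>2 / 2)"
    by (simp add: exp_minus inverse_eq_divide frac_le)
  also have "\<dots> \<le> 1 - a + a\<^sup>2 / 2"
  proof -
    have "(1 - a + a\<^sup>2 / 2) * (1 + a + a\<^sup>2 / 2) = 1 + a^4 / 4"
      by (simp add: algebra_simps power2_eq_square power4_eq_xxxx)
    then have "1 \<le> (1 - a + a\<^sup>2 / 2) * (1 + a + a\<^sup>2 / 2)" by simp
    then show ?thesis using pos by (simp add: pos_divide_le_eq)
  qed
  finally show ?thesis using exp_ge_add_one_self[of "- a"] by simp
qed

lemma iexp_third_order: "cmod (iexp x - 1 - \<i> * x + x\<^sup>2 / 2) \<le> \<bar>x\<bar>^3 / 6"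
proof -
  have eq: "iexp x - (\<Sum>k\<le>2. (\<i> * x)^k / fact k) = iexp x - 1 - \<i> * x + x\<^sup>2 / 2"
    by (simp add: numeral_2_eq_2 power2_eq_square mult_ac)
  show ?thesis using iexp_approx1[of x 2] unfolding eq by (simp add: fact_numeral)
qed

text \<open>Here y is an increment, v its random compensator and d the deterministic clock
  increment; the subtracted bracket consists of the terms y and y^2 - v that are orthogonal to the
  past. Three errors remain: the cubic Taylor remainder with |y|^3 \<le> \<epsilon> y^2, the
  quadratic error of exp (- \<theta>^2 d / 2) with d^2 \<le> \<epsilon> d (whence 1/8 = (1/2)^2 /
  2), and the replacement of v by d.\<close>

lemma characteristic_step_remainder:
  fixes y v d \<theta> \<epsilon> :: real
  assumes "\<bar>y\<bar> \<le> \<epsilon>" "v \<le> d" "0 \<le> d" "d \<le> \<epsilon>"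
  shows "cmod (iexp (\<theta> * y) - complex_of_real (exp (- (\<theta>\<^sup>2 * d / 2))) - (\<i> * \<theta> * y - \<theta>\<^sup>2 / 2 * (y\<^sup>2 - v)))
    \<le> \<bar>\<theta>\<bar>^3 / 6 * \<epsilon> * y\<^sup>2 + \<theta>^4 / 8 * \<epsilon> * d + \<theta>\<^sup>2 / 2 * (d - v)"
proof -
  define a where "a = \<theta>\<^sup>2 * d / 2"
  have "0 \<le> a" using assms by (simp add: a_def)
  have "iexp (\<theta> * y) - exp (- a) - (\<i> * \<theta> * y - \<theta>\<^sup>2 / 2 * (y\<^sup>2 - v)) =
     (iexp (\<theta> * y) - 1 - \<i> * (\<theta> * y) + (\<theta> * y)\<^sup>2 / 2) -
     complex_of_real (exp (- a) - 1 + a) + complex_of_real (\<theta>\<^sup>2 / 2 * (d - v))"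
    by (simp add: a_def field_simps power2_eq_square exp_of_real)
  also have "cmod \<dots> \<le> cmod (iexp (\<theta> * y) - 1 - \<i> * (\<theta> * y) + (\<theta> * y)\<^sup>2 / 2) +
     cmod (complex_of_real (exp (- a) - 1 + a)) + cmod (complex_of_real (\<theta>\<^sup>2 / 2 * (d - v)))"
    by (intro order.trans[OF norm_triangle_ineq] add_mono norm_triangle_ineq4 order_refl)
  also have "\<dots> \<le> \<bar>\<theta>\<bar>^3 / 6 * \<epsilon> * y\<^sup>2 + \<theta>^4 / 8 * \<epsilon> * d + \<theta>\<^sup>2 / 2 * (d - v)"
  proof (intro add_mono)
    have "cmod (iexp (\<theta> * y) - 1 - \<i> * (\<theta> * y) + (\<theta> * y)\<^sup>2 / 2) \<le> \<bar>\<theta> * y\<bar>^3 / 6"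
      using iexp_third_order[of "\<theta> * y"] by simp
    also have "\<dots> = \<bar>\<theta>\<bar>^3 / 6 * (\<bar>y\<bar> * y\<^sup>2)"
      using power_Suc[of "\<bar>y\<bar>" 2] by (simp add: abs_mult power_mult_distrib del: power_Suc)
    also have "\<dots> \<le> \<bar>\<theta>\<bar>^3 / 6 * (\<epsilon> * y\<^sup>2)"
      by (intro mult_left_mono mult_right_mono assms) auto
    finally show "cmod (iexp (\<theta> * y) - 1 - \<i> * (\<theta> * y) + (\<theta> * y)\<^sup>2 / 2) \<le> \<bar>\<theta>\<bar>^3 / 6 * \<epsilon> * y\<^sup>2"
      by (simp add: mult.assoc)
    have "cmod (complex_of_real (exp (- a) - 1 + a)) \<le> a\<^sup>2 / 2"
      unfolding norm_of_real by (rule exp_minus_quadratic_bound[OF \<open>0 \<le> a\<close>])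
    also have "\<dots> = \<theta>^4 / 8 * (d * d)"
      by (simp add: a_def power2_eq_square power4_eq_xxxx)
    also have "\<dots> \<le> \<theta>^4 / 8 * (\<epsilon> * d)"
      by (intro mult_left_mono mult_right_mono assms) auto
    finally show "cmod (complex_of_real (exp (- a) - 1 + a)) \<le> \<theta>^4 / 8 * \<epsilon> * d"
      by (simp add: mult.assoc)
    show "cmod (complex_of_real (\<theta>\<^sup>2 / 2 * (d - v))) \<le> \<theta>\<^sup>2 / 2 * (d - v)"
      unfolding norm_of_real using assms by simp
  qed
  finally show ?thesis by (simp add: a_def)
qed

text \<open>Real and imaginary part of G are admissible real weights, which transfers the
  orthogonality relations to the complex exponential of the past.\<close>

lemma complex_integral_eq_0_if_real_orthogonal:
  fixes G :: "'a \<Rightarrow> complex" and D :: "'a \<Rightarrow> real"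
  assumes N: "subalgebra M N" and G: "G \<in> borel_measurable N" "\<And>x. cmod (G x) \<le> 1"
    and D: "integrable M D"
    and orth: "\<And>\<xi>. \<xi> \<in> borel_measurable N \<Longrightarrow> (\<And>x. \<bar>\<xi> x\<bar> \<le> 1) \<Longrightarrow> (\<integral>x. \<xi> x * D x \<partial>M) = 0"
  shows "integrable M (\<lambda>x. G x * of_real (D x))" and "(\<integral>x. G x * of_real (D x) \<partial>M) = 0"
proof -
  have [measurable]: "G \<in> borel_measurable M" by (rule measurable_from_subalg[OF N G(1)])
  show int: "integrable M (\<lambda>x. G x * of_real (D x))"
  proof (rule Bochner_Integration.integrable_bound[OF D])
    show "AE x in M. norm (G x * of_real (D x)) \<le> norm (D x)"
      using mult_right_mono[OF G(2)] by (auto simp: norm_mult)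
  qed (use D in measurable)
  have "Re (\<integral>x. G x * of_real (D x) \<partial>M) = (\<integral>x. Re (G x) * D x \<partial>M)"
    using integral_Re[OF int] by simp
  also have "\<dots> = 0"
    by (rule orth) (use G in \<open>auto intro: order.trans[OF abs_Re_le_cmod]\<close>)
  finally have 1: "Re (\<integral>x. G x * of_real (D x) \<partial>M) = 0" .
  have "Im (\<integral>x. G x * of_real (D x) \<partial>M) = (\<integral>x. Im (G x) * D x \<partial>M)"
    using integral_Im[OF int] by simp
  also have "\<dots> = 0"
    by (rule orth) (use G in \<open>auto intro: order.trans[OF abs_Im_le_cmod]\<close>)
  finally show "(\<integral>x. G x * of_real (D x) \<partial>M) = 0" using 1 by (simp add: complex_eq_iff)
qed

context stochastic_basis
begin

text \<open>The squared increment is the increment of Y^2 minus 2 \<open>Y s\<close> times the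
  increment of Y. The cross term vanishes because \<open>\<xi> \<omega> * Y s \<omega>\<close> is a
  weight from the past; the bound on the increment makes it integrable.\<close>

lemma martingale_square_increment_orthogonal:
  assumes Y: "martingale M F Y" and Q: "martingale M F (\<lambda>t \<omega>. (Y t \<omega>)\<^sup>2 - V t \<omega>)"
    and st: "0 \<le> s" "s \<le> t" and bd: "AE \<omega> in M. \<bar>Y t \<omega> - Y s \<omega>\<bar> \<le> C"
    and \<xi>: "\<xi> \<in> borel_measurable (F s)" "\<And>\<omega>. \<bar>\<xi> \<omega>\<bar> \<le> 1"
  shows "(\<integral>\<omega>. \<xi> \<omega> * ((Y t \<omega> - Y s \<omega>)\<^sup>2 - (V t \<omega> - V s \<omega>)) \<partial>M) = 0"
proof -
  have int: "integrable M (Y s)" "integrable M (Y t)" and Ys: "Y s \<in> borel_measurable (F s)"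
    using Y st unfolding martingale_def adapted_process_def by auto
  have [measurable]: "Y s \<in> borel_measurable M" "Y t \<in> borel_measurable M" "\<xi> \<in> borel_measurable M"
    using int \<xi>(1) measurable_F_M[OF st(1)] by auto
  have \<xi>Y: "(\<lambda>\<omega>. \<xi> \<omega> * Y s \<omega>) \<in> borel_measurable (F s)" using \<xi>(1) Ys by measurable
  have i: "integrable M (\<lambda>\<omega>. \<xi> \<omega> * Y s \<omega> * (Y t \<omega> - Y s \<omega>))"
  proof (rule Bochner_Integration.integrable_bound)
    show "integrable M (\<lambda>\<omega>. C * Y s \<omega>)" using int by simp
    show "AE \<omega> in M. norm (\<xi> \<omega> * Y s \<omega> * (Y t \<omega> - Y s \<omega>)) \<le> norm (C * Y s \<omega>)"
      using bd
    proof eventually_elim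
      fix \<omega> assume "\<bar>Y t \<omega> - Y s \<omega>\<bar> \<le> C"
      then have "\<bar>\<xi> \<omega>\<bar> * \<bar>Y t \<omega> - Y s \<omega>\<bar> \<le> 1 * \<bar>C\<bar>" using \<xi>(2) by (intro mult_mono) auto
      then have "\<bar>\<xi> \<omega>\<bar> * \<bar>Y t \<omega> - Y s \<omega>\<bar> * \<bar>Y s \<omega>\<bar> \<le> \<bar>C\<bar> * \<bar>Y s \<omega>\<bar>" by (intro mult_right_mono) auto
      then show "norm (\<xi> \<omega> * Y s \<omega> * (Y t \<omega> - Y s \<omega>)) \<le> norm (C * Y s \<omega>)" by (simp add: abs_mult mult_ac)
    qed
  qed simp
  note a = martingale_increment_orthogonal[OF Y st \<xi>Y i]
  note b = martingale_increment_orthogonal_bounded[OF Q st \<xi>]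
  have "(\<integral>\<omega>. \<xi> \<omega> * ((Y t \<omega> - Y s \<omega>)\<^sup>2 - (V t \<omega> - V s \<omega>)) \<partial>M) =
     (\<integral>\<omega>. \<xi> \<omega> * ((Y t \<omega>)\<^sup>2 - V t \<omega> - ((Y s \<omega>)\<^sup>2 - V s \<omega>)) - 2 * (\<xi> \<omega> * Y s \<omega> * (Y t \<omega> - Y s \<omega>)) \<partial>M)"
    by (rule Bochner_Integration.integral_cong) (auto simp: power2_eq_square algebra_simps)
  also have "\<dots> = 0"
    using a b i by (subst Bochner_Integration.integral_diff) auto
  finally show ?thesis .
qed

text \<open>After integration against the past G the main terms vanish. Orthogonality with weight 1
  equates the mean of y^2 with that of v, which is at most d, so each remaining error is linear in d
  or in the mean of d - v. Such bounds add up to a telescoping sum over the grid.\<close>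

lemma characteristic_step:
  assumes Y: "martingale M F Y" and Q: "martingale M F (\<lambda>t \<omega>. (Y t \<omega>)\<^sup>2 - V t \<omega>)"
    and V: "integrable M (V s)" "integrable M (V t)"
    and st: "0 \<le> s" "s \<le> t" and bd: "AE \<omega> in M. \<bar>Y t \<omega> - Y s \<omega>\<bar> \<le> \<epsilon>"
    and d: "AE \<omega> in M. V t \<omega> - V s \<omega> \<le> d" "0 \<le> d" "d \<le> \<epsilon>"
    and G: "G \<in> borel_measurable (F s)" "\<And>\<omega>. cmod (G \<omega>) \<le> 1"
  shows "cmod ((\<integral>\<omega>. G \<omega> * iexp (\<theta> * (Y t \<omega> - Y s \<omega>)) \<partial>M) - complex_of_real (exp (- (\<theta>\<^sup>2 * d / 2))) * (\<integral>\<omega>. G \<omega> \<partial>M))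
    \<le> \<epsilon> * (\<bar>\<theta>\<bar>^3 / 6 + \<theta>^4 / 8) * d + \<theta>\<^sup>2 / 2 * (d - (\<integral>\<omega>. V t \<omega> - V s \<omega> \<partial>M))"
proof -
  define y where "y \<omega> = Y t \<omega> - Y s \<omega>" for \<omega>
  define v where "v \<omega> = V t \<omega> - V s \<omega>" for \<omega>
  have y: "integrable M y" and v: "integrable M v"
    using Y V st unfolding martingale_def y_def[abs_def] v_def[abs_def] by auto
  have [measurable]: "G \<in> borel_measurable M" "y \<in> borel_measurable M" "v \<in> borel_measurable M"
    using measurable_F_M[OF st(1) G(1)] y v by auto
  have bdy: "AE \<omega> in M. \<bar>y \<omega>\<bar> \<le> \<epsilon>" using bd by (simp add: y_def)
  have y2: "integrable M (\<lambda>\<omega>. (y \<omega>)\<^sup>2)"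
    by (rule integrable_const_bound[where B="\<epsilon>\<^sup>2"])
      (use bdy in \<open>auto simp: abs_le_square_iff[symmetric] elim!: eventually_mono\<close>)
  have orth1: "(\<integral>\<omega>. \<xi> \<omega> * y \<omega> \<partial>M) = 0" if "\<xi> \<in> borel_measurable (F s)" "\<And>\<omega>. \<bar>\<xi> \<omega>\<bar> \<le> 1" for \<xi>
    using martingale_increment_orthogonal_bounded(2)[OF Y st that] by (simp add: y_def)
  have orth2: "(\<integral>\<omega>. \<xi> \<omega> * ((y \<omega>)\<^sup>2 - v \<omega>) \<partial>M) = 0" if "\<xi> \<in> borel_measurable (F s)" "\<And>\<omega>. \<bar>\<xi> \<omega>\<bar> \<le> 1" for \<xi>
    using martingale_square_increment_orthogonal[OF Y Q st bd that] by (simp add: y_def v_def)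
  have y2v: "integrable M (\<lambda>\<omega>. (y \<omega>)\<^sup>2 - v \<omega>)" using y2 v by simp
  note c1 = complex_integral_eq_0_if_real_orthogonal[OF subalgebra_F[OF st(1)] G y orth1]
  note c2 = complex_integral_eq_0_if_real_orthogonal[OF subalgebra_F[OF st(1)] G y2v orth2]
  have Ey2: "(\<integral>\<omega>. (y \<omega>)\<^sup>2 \<partial>M) = (\<integral>\<omega>. v \<omega> \<partial>M)"
    using orth2[of "\<lambda>_. 1"] y2 v by simp
  have Ev: "(\<integral>\<omega>. v \<omega> \<partial>M) \<le> d"
    using integral_mono_AE[OF v, of "\<lambda>_. d"] d(1) by (simp add: prob_space flip: v_def)
  have iG: "integrable M G"
    by (rule integrable_const_bound[where B=1]) (use G(2) in auto)
  have iE: "integrable M (\<lambda>\<omega>. G \<omega> * iexp (\<theta> * y \<omega>))"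
    by (rule integrable_const_bound[where B=1]) (use G(2) in \<open>auto simp: norm_mult\<close>)
  let ?a = "exp (- (\<theta>\<^sup>2 * d / 2)) :: real"
  let ?r = "\<lambda>\<omega>. G \<omega> * (iexp (\<theta> * y \<omega>) - ?a - (\<i> * \<theta> * y \<omega> - \<theta>\<^sup>2 / 2 * ((y \<omega>)\<^sup>2 - v \<omega>)))"
  let ?b = "\<lambda>\<omega>. \<bar>\<theta>\<bar>^3 / 6 * \<epsilon> * (y \<omega>)\<^sup>2 + \<theta>^4 / 8 * \<epsilon> * d + \<theta>\<^sup>2 / 2 * (d - v \<omega>)"
  have eq: "?r \<omega> = G \<omega> * iexp (\<theta> * y \<omega>) - G \<omega> * ?a -
      (\<i> * \<theta> * (G \<omega> * of_real (y \<omega>)) - \<theta>\<^sup>2 / 2 * (G \<omega> * of_real ((y \<omega>)\<^sup>2 - v \<omega>)))" for \<omega>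
    by (simp add: field_simps)
  have ir: "integrable M ?r"
    unfolding eq by (intro Bochner_Integration.integrable_diff integrable_mult_right integrable_mult_left c1 c2 iG iE)
  have "(\<integral>\<omega>. ?r \<omega> \<partial>M) = (\<integral>\<omega>. G \<omega> * iexp (\<theta> * y \<omega>) \<partial>M) - ?a * (\<integral>\<omega>. G \<omega> \<partial>M)"
    unfolding eq using c1 c2 iG iE by (simp add: mult.commute)
  then have "cmod ((\<integral>\<omega>. G \<omega> * iexp (\<theta> * y \<omega>) \<partial>M) - ?a * (\<integral>\<omega>. G \<omega> \<partial>M)) = cmod (\<integral>\<omega>. ?r \<omega> \<partial>M)"
    by simp
  also have "\<dots> \<le> (\<integral>\<omega>. cmod (?r \<omega>) \<partial>M)" by (rule integral_norm_bound)
  also have "\<dots> \<le> (\<integral>\<omega>. ?b \<omega> \<partial>M)"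
  proof (rule integral_mono_AE)
    show "integrable M (\<lambda>\<omega>. cmod (?r \<omega>))" using ir by (rule integrable_norm)
    show "integrable M ?b" using y2 v by simp
    show "AE \<omega> in M. cmod (?r \<omega>) \<le> ?b \<omega>"
      using bdy d(1)
    proof eventually_elim
      fix \<omega> assume *: "\<bar>y \<omega>\<bar> \<le> \<epsilon>" "V t \<omega> - V s \<omega> \<le> d"
      have "cmod (?r \<omega>) \<le> 1 * cmod (iexp (\<theta> * y \<omega>) - ?a - (\<i> * \<theta> * y \<omega> - \<theta>\<^sup>2 / 2 * ((y \<omega>)\<^sup>2 - v \<omega>)))"
        unfolding norm_mult by (rule mult_right_mono[OF G(2)]) simp
      also have "\<dots> \<le> ?b \<omega>"
        using characteristic_step_remainder[OF *(1) _ d(2,3), of "v \<omega>" \<theta>] *(2) by (simp add: v_def)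
      finally show "cmod (?r \<omega>) \<le> ?b \<omega>" .
    qed
  qed
  also have "\<dots> = \<bar>\<theta>\<bar>^3 / 6 * \<epsilon> * (\<integral>\<omega>. v \<omega> \<partial>M) + \<theta>^4 / 8 * \<epsilon> * d + \<theta>\<^sup>2 / 2 * (d - (\<integral>\<omega>. v \<omega> \<partial>M))"
    using y2 v by (simp add: Ey2 prob_space)
  also have "\<dots> \<le> \<bar>\<theta>\<bar>^3 / 6 * \<epsilon> * d + \<theta>^4 / 8 * \<epsilon> * d + \<theta>\<^sup>2 / 2 * (d - (\<integral>\<omega>. v \<omega> \<partial>M))"
    using Ev d by (intro add_mono mult_left_mono) auto
  also have "\<dots> = \<epsilon> * (\<bar>\<theta>\<bar>^3 / 6 + \<theta>^4 / 8) * d + \<theta>\<^sup>2 / 2 * (d - (\<integral>\<omega>. v \<omega> \<partial>M))"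
    by (simp add: algebra_simps)
  finally show ?thesis by (simp only: y_def v_def)
qed

text \<open>
  \<open>V\<close> is the clock \<open>q\<close> stopped together with \<open>Y\<close>. Compensating with the deterministic \<open>q\<close> instead
  of \<open>V\<close> keeps the exponential factors constant; the price is the last summand of the bound.
\<close>

lemma characteristic_estimate:
  assumes Y: "martingale M F Y" and Q: "martingale M F (\<lambda>t \<omega>. (Y t \<omega>)\<^sup>2 - V t \<omega>)"
    and V: "\<And>t. 0 \<le> t \<Longrightarrow> integrable M (V t)"
    and u: "0 \<le> u 0" "\<And>j. u j \<le> u (Suc j)"
    and bd: "\<And>j. j < k \<Longrightarrow> AE \<omega> in M. \<bar>Y (u (Suc j)) \<omega> - Y (u j) \<omega>\<bar> \<le> \<epsilon>"
    and Vq: "\<And>j. j < k \<Longrightarrow> AE \<omega> in M. V (u (Suc j)) \<omega> - V (u j) \<omega> \<le> q (u (Suc j)) - q (u j)"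
    and q: "\<And>j. j < k \<Longrightarrow> q (u j) \<le> q (u (Suc j))" "\<And>j. j < k \<Longrightarrow> q (u (Suc j)) - q (u j) \<le> \<epsilon>"
    and A: "A \<in> sets (F (u 0))"
    and "i \<le> k"
  shows "cmod ((\<integral>\<omega>. indicator A \<omega> * iexp (\<theta> * (Y (u i) \<omega> - Y (u 0) \<omega>)) \<partial>M) -
      complex_of_real (prob A * exp (- (\<theta>\<^sup>2 * (q (u i) - q (u 0)) / 2))))
    \<le> \<epsilon> * (\<bar>\<theta>\<bar>^3 / 6 + \<theta>^4 / 8) * (q (u i) - q (u 0)) +
      \<theta>\<^sup>2 / 2 * (q (u i) - q (u 0) - (\<integral>\<omega>. V (u i) \<omega> - V (u 0) \<omega> \<partial>M))"
  using \<open>i \<le> k\<close>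
proof (induction i)
  case 0
  have "A \<in> sets M" using A u sets_F_subset by blast
  then have "(\<integral>\<omega>. complex_of_real (indicator A \<omega>) \<partial>M) = complex_of_real (prob A)"
    by (simp add: Int_absorb2 sets.sets_into_space)
  then have "(\<integral>\<omega>. indicator A \<omega> \<partial>M) = complex_of_real (prob A)"
    by (simp only: of_real_indicator)
  then show ?case by simp
next
  case (Suc i)
  have mono: "u j \<le> u j'" if "j \<le> j'" for j j' using lift_Suc_mono_le[of u, OF u(2) that] .
  have u0: "0 \<le> u j" for j using mono[of 0 j] u(1) by simp
  let ?G = "\<lambda>\<omega>. indicator A \<omega> * iexp (\<theta> * (Y (u i) \<omega> - Y (u 0) \<omega>))"
  have G: "?G \<in> borel_measurable (F (u i))"
  proof -
    have "Y (u j) \<in> borel_measurable (F (u j))" for j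
      using Y u0 by (simp add: martingale_def adapted_process_def)
    then have [measurable]: "Y (u i) \<in> borel_measurable (F (u i))" "Y (u 0) \<in> borel_measurable (F (u i))"
      using measurable_F_mono[OF u0 mono] by blast+
    have [measurable]: "A \<in> sets (F (u i))" using A F_mono[OF u0 mono, of 0 i] by blast
    show ?thesis by measurable
  qed
  have G1: "cmod (?G \<omega>) \<le> 1" for \<omega> by (simp add: norm_mult indicator_def)
  let ?d = "q (u (Suc i)) - q (u i)" and ?a = "\<lambda>d. exp (- (\<theta>\<^sup>2 * d / 2)) :: real"
  let ?\<phi> = "\<lambda>i. (\<integral>\<omega>. indicator A \<omega> * iexp (\<theta> * (Y (u i) \<omega> - Y (u 0) \<omega>)) \<partial>M)"
  have "\<theta> * (Y (u (Suc i)) \<omega> - Y (u 0) \<omega>) = \<theta> * (Y (u i) \<omega> - Y (u 0) \<omega>) + \<theta> * (Y (u (Suc i)) \<omega> - Y (u i) \<omega>)" for \<omega>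
    by (simp add: algebra_simps)
  then have \<phi>: "(\<integral>\<omega>. ?G \<omega> * iexp (\<theta> * (Y (u (Suc i)) \<omega> - Y (u i) \<omega>)) \<partial>M) = ?\<phi> (Suc i)"
    by (simp only: of_real_add distrib_left exp_add mult.assoc)
  have "cmod (?\<phi> (Suc i) - ?a ?d * ?\<phi> i) \<le> \<epsilon> * (\<bar>\<theta>\<bar>^3 / 6 + \<theta>^4 / 8) * ?d + \<theta>\<^sup>2 / 2 * (?d - (\<integral>\<omega>. V (u (Suc i)) \<omega> - V (u i) \<omega> \<partial>M))"
  proof -
    note step = characteristic_step[OF Y Q V[OF u0] V[OF u0] u0 u(2) bd Vq _ _ G G1, of \<theta>]
    have "i < k" "0 \<le> ?d" "?d \<le> \<epsilon>" using Suc.prems q[of i] by auto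
    from step[OF this(1,1,2,3)] show ?thesis unfolding \<phi> .
  qed
  \<comment> \<open>The factor of the new cell has modulus at most 1, so the errors of earlier cells
    are not enlarged and merely add up.\<close>
  moreover have "cmod (?a ?d * ?\<phi> i - prob A * ?a (q (u (Suc i)) - q (u 0))) \<le>
    \<epsilon> * (\<bar>\<theta>\<bar>^3 / 6 + \<theta>^4 / 8) * (q (u i) - q (u 0)) +
      \<theta>\<^sup>2 / 2 * (q (u i) - q (u 0) - (\<integral>\<omega>. V (u i) \<omega> - V (u 0) \<omega> \<partial>M))"
  proof -
    have "?a (q (u (Suc i)) - q (u 0)) = ?a ?d * ?a (q (u i) - q (u 0))"
      unfolding exp_add[symmetric] by (simp add: field_simps)
    then have "?a ?d * ?\<phi> i - prob A * ?a (q (u (Suc i)) - q (u 0)) =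
      ?a ?d * (?\<phi> i - prob A * ?a (q (u i) - q (u 0)))"
      by (simp only: of_real_mult right_diff_distrib mult.left_commute)
    then have "cmod (?a ?d * ?\<phi> i - prob A * ?a (q (u (Suc i)) - q (u 0))) =
      ?a ?d * cmod (?\<phi> i - prob A * ?a (q (u i) - q (u 0)))"
      by (simp only: norm_mult norm_of_real abs_exp_cancel)
    also have "\<dots> \<le> 1 * cmod (?\<phi> i - prob A * ?a (q (u i) - q (u 0)))"
      by (rule mult_right_mono) (use q(1)[of i] Suc.prems in auto)
    finally show ?thesis using Suc by simp
  qed
  ultimately have "cmod (?\<phi> (Suc i) - prob A * ?a (q (u (Suc i)) - q (u 0))) \<le>
    (\<epsilon> * (\<bar>\<theta>\<bar>^3 / 6 + \<theta>^4 / 8) * ?d + \<theta>\<^sup>2 / 2 * (?d - (\<integral>\<omega>. V (u (Suc i)) \<omega> - V (u i) \<omega> \<partial>M))) +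
    (\<epsilon> * (\<bar>\<theta>\<bar>^3 / 6 + \<theta>^4 / 8) * (q (u i) - q (u 0)) +
      \<theta>\<^sup>2 / 2 * (q (u i) - q (u 0) - (\<integral>\<omega>. V (u i) \<omega> - V (u 0) \<omega> \<partial>M)))"
    by (rule norm_diff_triangle_le)
  also have "\<dots> = \<epsilon> * (\<bar>\<theta>\<bar>^3 / 6 + \<theta>^4 / 8) * (q (u (Suc i)) - q (u 0)) +
      \<theta>\<^sup>2 / 2 * (q (u (Suc i)) - q (u 0) - (\<integral>\<omega>. V (u (Suc i)) \<omega> - V (u 0) \<omega> \<partial>M))"
    using V[OF u0, of 0] V[OF u0, of i] V[OF u0, of "Suc i"] by (simp add: field_simps)
  finally show ?case .
qed

end

section \<open>Stopping when the oscillation on a grid becomes large\<close>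

text \<open>A countable dense subset of [a, b], namely the points with rational coordinates relative
  to its end points. Division by zero makes n = 0 contribute the left end point.\<close>

definition interval_grid :: "real \<Rightarrow> real \<Rightarrow> real set" where
  "interval_grid a b = (\<lambda>(i, n). a + (b - a) * (real i / real n)) ` {(i, n). i \<le> n}"

lemma countable_interval_grid: "countable (interval_grid a b)"
  unfolding interval_grid_def by simp

lemma interval_grid_subset:
  assumes "a \<le> b"
  shows "interval_grid a b \<subseteq> {a..b}"
proof -
  have "a + (b - a) * (real i / real n) \<in> {a..b}" if "i \<le> n" for i n
  proof -
    have "0 \<le> real i / real n" "real i / real n \<le> 1" using that by (auto simp: divide_le_eq)
    then have "0 \<le> (b - a) * (real i / real n)" "(b - a) * (real i / real n) \<le> b - a"
      using assms mult_left_le[of "real i / real n" "b - a"] by auto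
    then show ?thesis by simp
  qed
  then show ?thesis by (auto simp: interval_grid_def)
qed

lemma interval_grid_dense:
  assumes w: "w \<in> {a..b}"
  obtains v where "\<And>n. v n \<in> interval_grid a b" "v \<longlonglongrightarrow> w"
proof
  \<comment> \<open>Relative position of w, approximated below by rounding \<open>x * real n\<close>
    down. For a = b it is 0 by division by zero, and w = a is still recovered.\<close>
  define x where "x = (w - a) / (b - a)"
  have x: "0 \<le> x" "x \<le> 1" using w by (auto simp: x_def divide_le_eq)
  have wx: "w = a + (b - a) * x" using w by (auto simp: x_def)
  let ?v = "\<lambda>n::nat. a + (b - a) * (real (nat \<lfloor>x * real n\<rfloor>) / real n)"
  show "?v n \<in> interval_grid a b" for n
  proof -
    have "\<lfloor>x * real n\<rfloor> \<le> int n"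
      using floor_mono[OF mult_right_mono[OF x(2), of "real n"]] by simp
    then have "nat \<lfloor>x * real n\<rfloor> \<le> n" by simp
    then show ?thesis unfolding interval_grid_def by (intro image_eqI[of _ _ "(nat \<lfloor>x * real n\<rfloor>, n)"]) auto
  qed
  have fl: "real (nat \<lfloor>x * real n\<rfloor>) = of_int \<lfloor>x * real n\<rfloor>" for n
    using x by simp
  have "(\<lambda>n. real (nat \<lfloor>x * real n\<rfloor>) / real n) \<longlonglongrightarrow> x"
  proof (rule tendsto_sandwich)
    show "\<forall>\<^sub>F n in sequentially. x - inverse (real n) \<le> real (nat \<lfloor>x * real n\<rfloor>) / real n"
      using eventually_gt_at_top[of 0]
    proof eventually_elim
      fix n :: nat assume "0 < n"
      have "x * real n - 1 \<le> real (nat \<lfloor>x * real n\<rfloor>)" unfolding fl by linarith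
      then have "(x * real n - 1) / real n \<le> real (nat \<lfloor>x * real n\<rfloor>) / real n" by (rule divide_right_mono) simp
      then show "x - inverse (real n) \<le> real (nat \<lfloor>x * real n\<rfloor>) / real n"
        using \<open>0 < n\<close> by (simp add: diff_divide_distrib inverse_eq_divide)
    qed
    show "\<forall>\<^sub>F n in sequentially. real (nat \<lfloor>x * real n\<rfloor>) / real n \<le> x"
      using eventually_gt_at_top[of 0]
      by eventually_elim (unfold fl, simp add: divide_le_eq)
    show "(\<lambda>n. x - inverse (real n)) \<longlonglongrightarrow> x"
      using tendsto_diff[OF tendsto_const[of x] lim_inverse_n] by simp
  qed simp
  then have "?v \<longlonglongrightarrow> a + (b - a) * x" by (intro tendsto_intros)
  then show "?v \<longlonglongrightarrow> w" by (simp add: wx)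
qed

text \<open>The level may be attained only off the grid, so grid points are asked to come within 1 /
  (n + 1) of it. Conversely, the maximum over the compact interval is at least c - 1 / (n + 1) for
  all n, hence at least c. This turns reaching a level into countably many conditions on single
  times.\<close>

lemma reaches_iff_interval_grid:
  assumes f: "continuous_on {a..b} f" and ab: "a \<le> b"
  shows "(\<exists>w\<in>{a..b}. c \<le> f w) \<longleftrightarrow> (\<forall>n. \<exists>w\<in>interval_grid a b. c - 1 / real (Suc n) < f w)"
proof
  assume "\<exists>w\<in>{a..b}. c \<le> f w"
  then obtain w where w: "w \<in> {a..b}" "c \<le> f w" by blast
  obtain v where v: "\<And>n. v n \<in> interval_grid a b" "v \<longlonglongrightarrow> w" using interval_grid_dense[OF w(1)] by blast
  have "(\<lambda>n. f (v n)) \<longlonglongrightarrow> f w"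
    by (rule continuous_on_tendsto_compose[OF f v(2) w(1)]) (use subsetD[OF interval_grid_subset[OF ab] v(1)] in auto)
  show "\<forall>n. \<exists>w\<in>interval_grid a b. c - 1 / real (Suc n) < f w"
  proof
    fix n
    have "c - 1 / real (Suc n) < f w" using w(2) by (simp add: less_le_trans[of _ c])
    then have "\<forall>\<^sub>F m in sequentially. c - 1 / real (Suc n) < f (v m)"
      using \<open>(\<lambda>n. f (v n)) \<longlonglongrightarrow> f w\<close> by (rule order_tendstoD(1)[rotated])
    then obtain m where "c - 1 / real (Suc n) < f (v m)"
      by (auto simp: eventually_sequentially)
    then show "\<exists>w\<in>interval_grid a b. c - 1 / real (Suc n) < f w"
      using v(1) by blast
  qed
next
  assume *: "\<forall>n. \<exists>w\<in>interval_grid a b. c - 1 / real (Suc n) < f w"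
  obtain w where w: "w \<in> {a..b}" "\<And>v. v \<in> {a..b} \<Longrightarrow> f v \<le> f w"
    using continuous_attains_sup[OF compact_Icc _ f] ab by auto
  have "c - inverse (real (Suc n)) \<le> f w" for n
  proof -
    obtain v where "v \<in> interval_grid a b" "c - 1 / real (Suc n) < f v" using * by blast
    then show ?thesis
      using w(2)[of v] interval_grid_subset[OF ab] by (auto simp: inverse_eq_divide)
  qed
  moreover have "(\<lambda>n. c - inverse (real (Suc n))) \<longlonglongrightarrow> c"
    using tendsto_diff[OF tendsto_const[of c] LIMSEQ_inverse_real_of_nat] by simp
  ultimately have "c \<le> f w" by (intro LIMSEQ_le_const2) auto
  then show "\<exists>w\<in>{a..b}. c \<le> f w" using w(1) by blast
qed

text \<open>The first time at which the path is \<epsilon> away from its value at the left end of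
  the current cell; it is \<infinity> if this happens in none of the k cells.\<close>

definition oscillation_time :: "(real \<Rightarrow> 'a \<Rightarrow> real) \<Rightarrow> (nat \<Rightarrow> real) \<Rightarrow> nat \<Rightarrow> real \<Rightarrow> 'a \<Rightarrow> ennreal" where
  "oscillation_time X u k \<epsilon> \<omega> =
     Inf {ennreal w | w. \<exists>j<k. w \<in> {u j..u (Suc j)} \<and> \<epsilon> \<le> \<bar>X w \<omega> - X (u j) \<omega>\<bar>}"

text \<open>The times that compete in the infimum form a finite union of compact sets, so the
  infimum is attained. Whether it is at most v thus depends on the path up to v alone, which makes
  it a stopping time for F itself, without passing to right limits.\<close>

lemma oscillation_time_le_iff:
  assumes cont: "continuous_on {0..} (\<lambda>t. X t \<omega>)" and u: "\<And>j. 0 \<le> u j" and v: "0 \<le> v"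
  shows "oscillation_time X u k \<epsilon> \<omega> \<le> ennreal v \<longleftrightarrow>
    (\<exists>j<k. \<exists>w\<in>{u j..min v (u (Suc j))}. \<epsilon> \<le> \<bar>X w \<omega> - X (u j) \<omega>\<bar>)"
proof
  assume le: "oscillation_time X u k \<epsilon> \<omega> \<le> ennreal v"
  define C where "C = (\<Union>j<k. {u j..u (Suc j)} \<inter> (\<lambda>w. \<bar>X w \<omega> - X (u j) \<omega>\<bar>) -` {\<epsilon>..})"
  have osc: "oscillation_time X u k \<epsilon> \<omega> = Inf (ennreal ` C)"
  proof -
    have "C = {w. \<exists>j<k. w \<in> {u j..u (Suc j)} \<and> \<epsilon> \<le> \<bar>X w \<omega> - X (u j) \<omega>\<bar>}" by (auto simp: C_def)
    then show ?thesis by (simp only: oscillation_time_def setcompr_eq_image)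
  qed
  have C: "compact C"
    unfolding C_def
  proof (intro compact_UN finite_lessThan ballI)
    fix j
    have c: "continuous_on {u j..u (Suc j)} (\<lambda>w. \<bar>X w \<omega> - X (u j) \<omega>\<bar>)"
      by (intro continuous_intros continuous_on_subset[OF cont]) (use u[of j] in auto)
    have "closed ({u j..u (Suc j)} \<inter> (\<lambda>w. \<bar>X w \<omega> - X (u j) \<omega>\<bar>) -` {\<epsilon>..})"
      by (rule continuous_closed_preimage[OF c]) auto
    then show "compact ({u j..u (Suc j)} \<inter> (\<lambda>w. \<bar>X w \<omega> - X (u j) \<omega>\<bar>) -` {\<epsilon>..})"
      using compact_Int_closed[OF compact_Icc[of "u j" "u (Suc j)"]] by (metis Int_left_absorb)
  qed
  have "C \<noteq> {}" using le osc by (auto simp: top_unique)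
  then obtain w where w: "w \<in> C" "\<And>x. x \<in> C \<Longrightarrow> w \<le> x" using compact_attains_inf[OF C] by blast
  then have "ennreal w \<le> Inf (ennreal ` C)" by (auto intro!: INF_greatest ennreal_leI)
  then have "ennreal w \<le> ennreal v" using le osc by simp
  then have "w \<le> v" using v by (simp add: ennreal_le_iff)
  then show "\<exists>j<k. \<exists>w\<in>{u j..min v (u (Suc j))}. \<epsilon> \<le> \<bar>X w \<omega> - X (u j) \<omega>\<bar>"
  proof -
    obtain j where "j < k" "w \<in> {u j..u (Suc j)}" "\<epsilon> \<le> \<bar>X w \<omega> - X (u j) \<omega>\<bar>"
      using w(1) by (auto simp: C_def)
    then show ?thesis using \<open>w \<le> v\<close> by (intro exI[of _ j] conjI bexI[of _ w]) auto
  qed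
next
  assume "\<exists>j<k. \<exists>w\<in>{u j..min v (u (Suc j))}. \<epsilon> \<le> \<bar>X w \<omega> - X (u j) \<omega>\<bar>"
  then obtain j w where "j < k" "w \<in> {u j..u (Suc j)}" "w \<le> v" "\<epsilon> \<le> \<bar>X w \<omega> - X (u j) \<omega>\<bar>" by auto
  then have "oscillation_time X u k \<epsilon> \<omega> \<le> ennreal w"
    unfolding oscillation_time_def by (intro Inf_lower CollectI exI[of _ w] exI[of _ j] conjI refl)
  then show "oscillation_time X u k \<epsilon> \<omega> \<le> ennreal v"
    using \<open>w \<le> v\<close> ennreal_leI order.trans by blast
qed

text \<open>The deviation is 0 at the left end of the cell. If it exceeded \<epsilon> at m, then by
  the intermediate value theorem it would equal \<epsilon> strictly before m, contradicting the
  infimum.\<close>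

lemma oscillation_before_oscillation_time:
  assumes cont: "continuous_on {0..} (\<lambda>t. X t \<omega>)" and u: "\<And>j. 0 \<le> u j"
    and j: "j < k" and m: "m \<in> {u j..u (Suc j)}" "ennreal m \<le> oscillation_time X u k \<epsilon> \<omega>" and \<epsilon>: "0 \<le> \<epsilon>"
  shows "\<bar>X m \<omega> - X (u j) \<omega>\<bar> \<le> \<epsilon>"
proof (rule ccontr)
  assume "\<not> ?thesis"
  then have gt: "\<epsilon> < \<bar>X m \<omega> - X (u j) \<omega>\<bar>" by simp
  have "continuous_on {u j..m} (\<lambda>w. \<bar>X w \<omega> - X (u j) \<omega>\<bar>)"
    by (intro continuous_intros continuous_on_subset[OF cont]) (use u[of j] in auto)
  then obtain w where w: "u j \<le> w" "w \<le> m" "\<bar>X w \<omega> - X (u j) \<omega>\<bar> = \<epsilon>"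
    using IVT'[of "\<lambda>w. \<bar>X w \<omega> - X (u j) \<omega>\<bar>" "u j" \<epsilon> m] gt \<epsilon> m by auto
  then have "oscillation_time X u k \<epsilon> \<omega> \<le> ennreal w"
    unfolding oscillation_time_def
    using j m by (intro Inf_lower CollectI exI[of _ w] exI[of _ j] conjI refl) auto
  then have "ennreal m \<le> ennreal w" using m(2) by simp
  then have "m \<le> w" using w(1) u[of j] by (simp add: ennreal_le_iff)
  then show False using w gt by simp
qed

context stochastic_basis
begin

lemma reaching_sets:
  fixes X :: "real \<Rightarrow> 'a \<Rightarrow> real"
  assumes ab: "0 \<le> a" "a \<le> b" and X: "\<And>v. v \<in> {a..b} \<Longrightarrow> X v \<in> borel_measurable (F b)"
    and cont: "AE \<omega> in M. continuous_on {a..b} (\<lambda>t. X t \<omega>)"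
  shows "{\<omega>\<in>space M. \<exists>w\<in>{a..b}. c \<le> X w \<omega>} \<in> sets (F b)"
proof -
  have b0: "0 \<le> b" using ab by simp
  have "{\<omega>\<in>space (F b). \<forall>n. \<exists>w\<in>interval_grid a b. c - 1 / real (Suc n) < X w \<omega>} \<in> sets (F b)"
  proof (intro sets.sets_Collect_countable_All sets.sets_Collect_countable_Ex' countable_interval_grid)
    fix n w assume "w \<in> interval_grid a b"
    then have "X w \<in> borel_measurable (F b)" using X interval_grid_subset[OF ab(2)] by blast
    then show "{\<omega>\<in>space (F b). c - 1 / real (Suc n) < X w \<omega>} \<in> sets (F b)" by measurable
  qed
  then show ?thesis
  proof (rule sets_F_AE_cong[OF b0])
    show "AE \<omega> in M. (\<omega> \<in> {\<omega>\<in>space (F b). \<forall>n. \<exists>w\<in>interval_grid a b. c - 1 / real (Suc n) < X w \<omega>}) =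
      (\<omega> \<in> {\<omega>\<in>space M. \<exists>w\<in>{a..b}. c \<le> X w \<omega>})"
      using cont
      by eventually_elim (use space_F[OF b0] reaches_iff_interval_grid[OF _ ab(2)] in auto)
  qed auto
qed

lemma extended_stopping_time_min:
  assumes "extended_stopping_time F \<sigma>" "extended_stopping_time F \<tau>"
  shows "extended_stopping_time F (\<lambda>\<omega>. min (\<sigma> \<omega>) (\<tau> \<omega>))"
  unfolding extended_stopping_time_def min_le_iff_disj
proof (intro allI impI)
  fix t :: real assume "0 \<le> t"
  then have [measurable]: "Measurable.pred (F t) (\<lambda>\<omega>. \<sigma> \<omega> \<le> ennreal t)" "Measurable.pred (F t) (\<lambda>\<omega>. \<tau> \<omega> \<le> ennreal t)"
    using assms by (auto simp: extended_stopping_time_def)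
  show "Measurable.pred (F t) (\<lambda>\<omega>. \<sigma> \<omega> \<le> ennreal t \<or> \<tau> \<omega> \<le> ennreal t)" by measurable
qed

lemma extended_stopping_time_oscillation_time:
  assumes X: "adapted_process F X" and cont: "continuous_process M X" and u: "\<And>j. 0 \<le> u j"
  shows "extended_stopping_time F (oscillation_time X u k \<epsilon>)"
  unfolding extended_stopping_time_def
proof (intro allI impI)
  fix v :: real assume v: "0 \<le> v"
  have E: "{\<omega>\<in>space M. \<exists>w\<in>{u j..min v (u (Suc j))}. \<epsilon> \<le> \<bar>X w \<omega> - X (u j) \<omega>\<bar>} \<in> sets (F v)" for j
  proof (cases "u j \<le> min v (u (Suc j))")
    case True
    have m: "X w \<in> borel_measurable (F (min v (u (Suc j))))" if "w \<in> {u j..min v (u (Suc j))}" for w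
      using X that u[of j] measurable_F_mono[of w "min v (u (Suc j))" "X w" borel]
      by (auto simp: adapted_process_def)
    have "{\<omega>\<in>space M. \<exists>w\<in>{u j..min v (u (Suc j))}. \<epsilon> \<le> \<bar>X w \<omega> - X (u j) \<omega>\<bar>} \<in> sets (F (min v (u (Suc j))))"
    proof (rule reaching_sets[OF u True])
      fix w assume "w \<in> {u j..min v (u (Suc j))}"
      then show "(\<lambda>\<omega>. \<bar>X w \<omega> - X (u j) \<omega>\<bar>) \<in> borel_measurable (F (min v (u (Suc j))))"
        using m[of w] m[of "u j"] True by auto
    next
      show "AE \<omega> in M. continuous_on {u j..min v (u (Suc j))} (\<lambda>w. \<bar>X w \<omega> - X (u j) \<omega>\<bar>)"
        using cont[unfolded continuous_process_def]
        by eventually_elim (intro continuous_intros, erule continuous_on_subset, use u[of j] in auto)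
    qed
    then show ?thesis using F_mono[of "min v (u (Suc j))" v] v u[of "Suc j"] by auto
  next
    case False
    then show ?thesis by auto
  qed
  have "{\<omega>\<in>space M. \<exists>j<k. \<exists>w\<in>{u j..min v (u (Suc j))}. \<epsilon> \<le> \<bar>X w \<omega> - X (u j) \<omega>\<bar>} =
     (\<Union>j<k. {\<omega>\<in>space M. \<exists>w\<in>{u j..min v (u (Suc j))}. \<epsilon> \<le> \<bar>X w \<omega> - X (u j) \<omega>\<bar>})"
    by auto
  also have "\<dots> \<in> sets (F v)" using E by (intro sets.finite_UN) auto
  finally have "{\<omega>\<in>space M. oscillation_time X u k \<epsilon> \<omega> \<le> ennreal v} \<in> sets (F v)"
  proof (rule sets_F_AE_cong[OF v])
    show "AE \<omega> in M. (\<omega> \<in> {\<omega>\<in>space M. \<exists>j<k. \<exists>w\<in>{u j..min v (u (Suc j))}. \<epsilon> \<le> \<bar>X w \<omega> - X (u j) \<omega>\<bar>}) =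
      (\<omega> \<in> {\<omega>\<in>space M. oscillation_time X u k \<epsilon> \<omega> \<le> ennreal v})"
      using cont[unfolded continuous_process_def]
      by eventually_elim (use oscillation_time_le_iff[of X _ u, OF _ u v] in auto)
  qed auto
  then show "Measurable.pred (F v) (\<lambda>\<omega>. oscillation_time X u k \<epsilon> \<omega> \<le> ennreal v)"
    using space_F[OF v] by (simp add: pred_def)
qed

end

lemma (in prob_space) prob_tendsto_0_if_AE_eventually_not:
  assumes B[measurable]: "\<And>n. B n \<in> events" and ev: "AE \<omega> in M. eventually (\<lambda>n. \<omega> \<notin> B n) sequentially"
  shows "(\<lambda>n. prob (B n)) \<longlonglongrightarrow> 0"
proof -
  have "(\<lambda>n. \<integral>\<omega>. indicator (B n) \<omega> \<partial>M) \<longlonglongrightarrow> (\<integral>\<omega>. 0 \<partial>M :: real)"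
  proof (rule integral_dominated_convergence[where w="\<lambda>_. 1"])
    show "AE \<omega> in M. (\<lambda>n. indicator (B n) \<omega>) \<longlonglongrightarrow> (0 :: real)"
      using ev
    proof eventually_elim
      fix \<omega> assume "eventually (\<lambda>n. \<omega> \<notin> B n) sequentially"
      then have "eventually (\<lambda>n. indicator (B n) \<omega> = (0::real)) sequentially"
        by eventually_elim simp
      then show "(\<lambda>n. indicator (B n) \<omega>) \<longlonglongrightarrow> (0 :: real)" by (rule tendsto_eventually)
    qed
  qed (auto simp: indicator_def)
  then show ?thesis using B by (simp add: Int_absorb2 sets.sets_into_space)
qed

section \<open>Characteristic function of the increments\<close>

lemma continuous_on_clip: "continuous_on {0..} (\<lambda>t. clip t x)"
proof (cases "x = top")
  case True
  have "continuous_on {0..} (\<lambda>t::real. t)" by (intro continuous_intros)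
  then show ?thesis using True clip_eq_time[of _ x] by (subst continuous_on_cong[OF refl, of _ _ "\<lambda>t. t"]) auto
next
  case False
  have "clip t x = min t (enn2real x)" if "0 \<le> t" for t
  proof (cases "ennreal t \<le> x")
    case True
    then have "t \<le> enn2real x" using enn2real_mono[OF True] \<open>x \<noteq> top\<close> that by (simp add: less_top)
    then show ?thesis using clip_eq_time[OF that True] by simp
  next
    case f: False
    then have "enn2real x \<le> t" using enn2real_leI[OF that, of x] by simp
    then show ?thesis using f by (simp add: clip_def min_def)
  qed
  moreover have "continuous_on {0..} (\<lambda>t. min t (enn2real x))" by (intro continuous_intros)
  ultimately show ?thesis by (subst continuous_on_cong[OF refl]) auto
qed

lemma continuous_process_stopped:
  assumes "continuous_process M X"
  shows "continuous_process M (stopped_process X \<tau>)"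
  using assms unfolding continuous_process_def
proof eventually_elim
  fix \<omega> assume "continuous_on {0..} (\<lambda>t. X t \<omega>)"
  from continuous_on_compose2[OF this continuous_on_clip[of "\<tau> \<omega>"]]
  show "continuous_on {0..} (\<lambda>t. stopped_process X \<tau> t \<omega>)"
    by (simp add: stopped_process_eq clip_nonneg image_subset_iff)
qed

context stochastic_basis
begin

text \<open>Localization yields martingales only after subtracting the initial value; for integrable
  \<open>X 0\<close> it can be put back.\<close>

lemma martingale_add_initial:
  assumes X: "martingale M F X" and c: "c \<in> borel_measurable (F 0)" "integrable M c"
  shows "martingale M F (\<lambda>t \<omega>. X t \<omega> + c \<omega>)"
proof (rule martingaleI)
  show "(\<lambda>\<omega>. X t \<omega> + c \<omega>) \<in> borel_measurable (F t)" if "0 \<le> t" for t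
    using X that measurable_F_mono[OF order_refl that c(1)] by (auto simp: martingale_def adapted_process_def)
  show "integrable M (\<lambda>\<omega>. X t \<omega> + c \<omega>)" if "0 \<le> t" for t
    using X that c by (auto simp: martingale_def)
  fix s t :: real and A assume st: "0 \<le> s" "s \<le> t" and A: "A \<in> sets (F s)"
  have AM: "A \<in> sets M" using A st(1) sets_F_subset by blast
  have i: "integrable M (\<lambda>\<omega>. indicator A \<omega> * (X v \<omega> + c \<omega>))" if "0 \<le> v" for v
  proof -
    have "integrable M (\<lambda>\<omega>. X v \<omega> + c \<omega>)" using X that c by (auto simp: martingale_def)
    from integrable_mult_indicator[OF AM this] show ?thesis by simp
  qed
  have "(\<integral>\<omega>. indicator A \<omega> * (X t \<omega> + c \<omega>) \<partial>M) - (\<integral>\<omega>. indicator A \<omega> * (X s \<omega> + c \<omega>) \<partial>M) =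
    (\<integral>\<omega>. indicator A \<omega> * (X t \<omega> - X s \<omega>) \<partial>M)"
    using i[of s] i[of t] st
    by (subst Bochner_Integration.integral_diff[symmetric]) (auto simp: algebra_simps)
  also have "\<dots> = 0"
    by (rule martingale_increment_orthogonal_bounded(2)[OF X st, where C=1]) (use A in \<open>auto simp: indicator_def\<close>)
  finally show "(\<integral>\<omega>. indicator A \<omega> * (X t \<omega> + c \<omega>) \<partial>M) = (\<integral>\<omega>. indicator A \<omega> * (X s \<omega> + c \<omega>) \<partial>M)"
    by simp
qed

lemma martingale_cong:
  assumes X: "martingale M F X" and eq: "\<And>t. 0 \<le> t \<Longrightarrow> X t = Y t"
  shows "martingale M F Y"
  unfolding martingale_def adapted_process_def
proof (intro conjI allI impI)
  fix s t :: real assume "0 \<le> s" "s \<le> t"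
  then have "AE \<omega> in M. real_cond_exp M (F s) (X t) \<omega> = X s \<omega>" "X s = Y s" "X t = Y t"
    using X eq by (auto simp: martingale_def)
  then show "AE \<omega> in M. real_cond_exp M (F s) (Y t) \<omega> = Y s \<omega>" by (simp only:)
qed (use X eq in \<open>simp_all add: martingale_def adapted_process_def\<close>)

text \<open>Each process comes with its own localizing sequence. Stopping the localized martingale
  once more allows a single stopping time to serve Z and Z^2 - q.\<close>

lemma localized_martingale_stopped:
  assumes X: "adapted_process F X" "continuous_process M X" "integrable M (X 0)"
    and m: "martingale M F (\<lambda>t \<omega>. stopped_process X \<tau> t \<omega> - X 0 \<omega>)"
    and \<kappa>: "extended_stopping_time F \<kappa>"
  shows "martingale M F (stopped_process X (\<lambda>\<omega>. min (\<tau> \<omega>) (\<kappa> \<omega>)))"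
proof -
  have "X 0 \<in> borel_measurable (F 0)" using X by (simp add: adapted_process_def)
  from martingale_add_initial[OF m this X(3)] have "martingale M F (stopped_process X \<tau>)" by simp
  from martingale_stopped[OF this continuous_process_stopped[OF X(2)] \<kappa>]
  show ?thesis by (rule martingale_cong[OF _ stopped_stopped_process])
qed

text \<open>A continuous path is uniformly continuous on [s, t], so on a sufficiently fine grid it
  does not move by \<epsilon> within a cell; almost every path thus leaves these events
  eventually.\<close>

lemma prob_oscillation_time_tendsto_0:
  assumes X: "adapted_process F X" and cont: "continuous_process M X" and st: "0 \<le> s" "s \<le> t" and \<epsilon>: "0 < \<epsilon>"
  shows "(\<lambda>k. prob {\<omega>\<in>space M. oscillation_time X (\<lambda>j. s + (t - s) * real j / real (Suc k)) (Suc k) \<epsilon> \<omega> \<le> ennreal t}) \<longlonglongrightarrow> 0"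
proof -
  define u where "u = (\<lambda>(k::nat) (j::nat). s + (t - s) * real j / real (Suc k))"
  have t0: "0 \<le> t" using st by simp
  have us: "s \<le> u k j" for k j
    unfolding u_def using st by (simp del: of_nat_Suc)
  then have u0: "0 \<le> u k j" for k j using st(1) by (rule order.trans[rotated])
  have u_step: "u k (Suc j) = u k j + (t - s) * inverse (real (Suc k))" for k j
    unfolding u_def of_nat_Suc[of j]
    by (simp add: divide_inverse distrib_left distrib_right add_ac del: of_nat_Suc)
  have "(\<lambda>k. prob {\<omega>\<in>space M. oscillation_time X (u k) (Suc k) \<epsilon> \<omega> \<le> ennreal t}) \<longlonglongrightarrow> 0"
  proof (rule prob_tendsto_0_if_AE_eventually_not)
  show "{\<omega>\<in>space M. oscillation_time X (u k) (Suc k) \<epsilon> \<omega> \<le> ennreal t} \<in> events" for k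
    by (rule sets_F_subset[OF t0 extended_stopping_timeD(1)[OF _ t0]])
      (rule extended_stopping_time_oscillation_time[OF X cont, of "u k", OF u0])
  show "AE \<omega> in M. \<forall>\<^sub>F k in sequentially. \<omega> \<notin> {\<omega>\<in>space M. oscillation_time X (u k) (Suc k) \<epsilon> \<omega> \<le> ennreal t}"
    using cont[unfolded continuous_process_def]
  proof eventually_elim
    fix \<omega> assume c: "continuous_on {0..} (\<lambda>t. X t \<omega>)"
    have "uniformly_continuous_on {s..t} (\<lambda>t. X t \<omega>)"
      by (intro compact_uniformly_continuous continuous_on_subset[OF c]) (use st in auto)
    then obtain \<delta> where \<delta>: "0 < \<delta>" "\<And>x y. x \<in> {s..t} \<Longrightarrow> y \<in> {s..t} \<Longrightarrow> dist y x < \<delta> \<Longrightarrow> dist (X y \<omega>) (X x \<omega>) < \<epsilon>"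
      using \<epsilon> unfolding uniformly_continuous_on_def by metis
    have "(\<lambda>k. (t - s) * inverse (real (Suc k))) \<longlonglongrightarrow> (t - s) * 0"
      by (intro tendsto_intros LIMSEQ_inverse_real_of_nat)
    then have "\<forall>\<^sub>F k in sequentially. (t - s) * inverse (real (Suc k)) < \<delta>"
      using \<delta>(1) by (intro order_tendstoD(2)) auto
    then show "\<forall>\<^sub>F k in sequentially. \<omega> \<notin> {\<omega>\<in>space M. oscillation_time X (u k) (Suc k) \<epsilon> \<omega> \<le> ennreal t}"
    proof eventually_elim
      fix k assume k: "(t - s) * inverse (real (Suc k)) < \<delta>"
      have "\<not> (\<exists>j<Suc k. \<exists>w\<in>{u k j..min t (u k (Suc j))}. \<epsilon> \<le> \<bar>X w \<omega> - X (u k j) \<omega>\<bar>)"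
      proof (intro notI, elim exE bexE conjE)
        fix j w assume jw: "j < Suc k" "w \<in> {u k j..min t (u k (Suc j))}" "\<epsilon> \<le> \<bar>X w \<omega> - X (u k j) \<omega>\<bar>"
        have "dist w (u k j) < \<delta>" using jw k u_step[of k j] by (auto simp: dist_real_def)
        then have "dist (X w \<omega>) (X (u k j) \<omega>) < \<epsilon>"
          using jw us[of k j] by (intro \<delta>(2)) auto
        then show False using jw(3) by (simp add: dist_real_def)
      qed
      then show "\<omega> \<notin> {\<omega>\<in>space M. oscillation_time X (u k) (Suc k) \<epsilon> \<omega> \<le> ennreal t}"
        using oscillation_time_le_iff[of X \<omega> "u k", OF c u0 t0] by auto
    qed
  qed
  qed
  then show ?thesis by (simp only: u_def)
qed

lemma norm_integral_diff_le_prob: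
  fixes f g :: "'a \<Rightarrow> complex"
  assumes f: "f \<in> borel_measurable M" "\<And>\<omega>. norm (f \<omega>) \<le> 1" and g: "g \<in> borel_measurable M" "\<And>\<omega>. norm (g \<omega>) \<le> 1"
    and B: "B \<in> events" and eq: "\<And>\<omega>. \<omega> \<in> space M - B \<Longrightarrow> f \<omega> = g \<omega>"
  shows "norm ((\<integral>\<omega>. f \<omega> \<partial>M) - (\<integral>\<omega>. g \<omega> \<partial>M)) \<le> 2 * prob B"
proof -
  have i: "integrable M f" "integrable M g"
    using f g by (auto intro!: integrable_const_bound[where B=1])
  have "norm ((\<integral>\<omega>. f \<omega> \<partial>M) - (\<integral>\<omega>. g \<omega> \<partial>M)) \<le> (\<integral>\<omega>. norm (f \<omega> - g \<omega>) \<partial>M)"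
    using integral_norm_bound[of M "\<lambda>\<omega>. f \<omega> - g \<omega>"] i by simp
  also have "\<dots> \<le> (\<integral>\<omega>. 2 * indicator B \<omega> \<partial>M)"
  proof (rule integral_mono)
    show "norm (f \<omega> - g \<omega>) \<le> 2 * indicator B \<omega>" if "\<omega> \<in> space M" for \<omega>
      using eq[of \<omega>] that norm_triangle_ineq4[of "f \<omega>" "g \<omega>"] f(2)[of \<omega>] g(2)[of \<omega>]
      by (auto simp: indicator_def)
  qed (use i B in \<open>auto simp: less_top[symmetric]\<close>)
  also have "\<dots> = 2 * prob B"
    using B by (simp add: Int_absorb2 sets.sets_into_space)
  finally show ?thesis .
qed

text \<open>Allowing every A in \<open>F s\<close> makes this a statement about the conditional
  characteristic function: it determines the law of the increment and its independence from the past
  at once.\<close>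

lemma increment_characteristic_function:
  assumes cont: "continuous_process M Z" and loc: "local_martingale M F Z" and Z0: "AE \<omega> in M. Z 0 \<omega> = 0"
    and qv: "is_quadratic_variation M F Z (\<lambda>t \<omega>. q t)"
    and st: "0 \<le> s" "s \<le> t" and A: "A \<in> sets (F s)"
  shows "(\<integral>\<omega>. indicator A \<omega> * iexp (\<theta> * (Z t \<omega> - Z s \<omega>)) \<partial>M) =
    complex_of_real (prob A * exp (- (\<theta>\<^sup>2 * (q t - q s) / 2)))" (is "?L = ?R")
proof -
  have t0: "0 \<le> t" using st by simp
  have ad: "adapted_process F Z" using loc by (simp add: local_martingale_def)
  have q: "continuous_on {0..} q" "q 0 = 0" and mono: "mono_on {0..} q"
    using qv by (auto simp: is_quadratic_variation_def continuous_process_def)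
  have q_mono: "q x \<le> q y" if "0 \<le> x" "x \<le> y" for x y
    using mono that by (auto simp: mono_on_def)
  have ZM: "Z v \<in> borel_measurable M" if "0 \<le> v" for v
    using ad that measurable_F_M[OF that] unfolding adapted_process_def by blast
  obtain \<tau> where \<tau>: "\<And>n. extended_stopping_time F (\<tau> n)" "AE \<omega> in M. (\<lambda>n. \<tau> n \<omega>) \<longlonglongrightarrow> \<infinity>"
    "\<And>n. martingale M F (\<lambda>t \<omega>. stopped_process Z (\<tau> n) t \<omega> - Z 0 \<omega>)"
    using loc unfolding local_martingale_def by (auto simp: AE_conj_iff)
  define Q where "Q t \<omega> = (Z t \<omega>)\<^sup>2 - q t" for t \<omega>
  have locQ: "local_martingale M F Q"
    using qv unfolding is_quadratic_variation_def Q_def[abs_def] by blast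
  obtain \<sigma> where \<sigma>: "\<And>n. extended_stopping_time F (\<sigma> n)" "AE \<omega> in M. (\<lambda>n. \<sigma> n \<omega>) \<longlonglongrightarrow> \<infinity>"
    "\<And>n. martingale M F (\<lambda>t \<omega>. stopped_process Q (\<sigma> n) t \<omega> - Q 0 \<omega>)"
    using locQ unfolding local_martingale_def by (auto simp: AE_conj_iff)
  have adQ: "adapted_process F Q"
    using ad unfolding adapted_process_def Q_def[abs_def] by auto
  have contQ: "continuous_process M Q"
    using cont unfolding continuous_process_def Q_def
    by eventually_elim (intro continuous_intros q)
  have "integrable M (Z 0) \<longleftrightarrow> integrable M (\<lambda>_. 0::real)"
    using Z0 ZM by (intro integrable_cong_AE) auto
  then have intZ0: "integrable M (Z 0)" by simp
  have "integrable M (Q 0) \<longleftrightarrow> integrable M (\<lambda>_. 0::real)"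
  proof (rule integrable_cong_AE)
    show "Q 0 \<in> borel_measurable M"
      using adQ measurable_F_M[OF order_refl] unfolding adapted_process_def by blast
    show "AE \<omega> in M. Q 0 \<omega> = 0" using Z0 by eventually_elim (simp add: Q_def q)
  qed simp
  then have intQ0: "integrable M (Q 0)" by simp
  \<comment> \<open>The first two summands are the Taylor errors. The third is \<theta>^2 / 2 times
    the defect of the stopped clock, at most 2 \<epsilon> (q t - q s). The 4 comes from undoing the
    stopping on an event of probability at most 2 \<epsilon>, where integrands of modulus at most 1
    differ by at most 2.\<close>
  define C where "C = (\<bar>\<theta>\<bar>^3 / 6 + \<theta>^4 / 8 + \<theta>\<^sup>2) * (q t - q s) + 4"
  have qts: "0 \<le> q t - q s" using q_mono[OF st] by simp
  have C: "0 < C" unfolding C_def using qts by (intro add_nonneg_pos mult_nonneg_nonneg) auto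
  have key: "cmod (?L - ?R) \<le> \<epsilon> * C" if \<epsilon>: "0 < \<epsilon>" for \<epsilon>
  proof -
    let ?B = "\<lambda>n. {\<omega>\<in>space M. min (\<tau> n \<omega>) (\<sigma> n \<omega>) \<le> ennreal t}"
    have B: "?B n \<in> events" for n
      using extended_stopping_timeD(1)[OF extended_stopping_time_min[OF \<tau>(1) \<sigma>(1)] t0] sets_F_subset[OF t0] by blast
    have "(\<lambda>n. prob (?B n)) \<longlonglongrightarrow> 0"
    proof (rule prob_tendsto_0_if_AE_eventually_not[of ?B, OF B])
      show "AE \<omega> in M. \<forall>\<^sub>F n in sequentially. \<omega> \<notin> ?B n"
        using \<tau>(2) \<sigma>(2)
      proof eventually_elim
        fix \<omega> assume "(\<lambda>n. \<tau> n \<omega>) \<longlonglongrightarrow> \<infinity>" "(\<lambda>n. \<sigma> n \<omega>) \<longlonglongrightarrow> \<infinity>"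
        then have "\<forall>\<^sub>F n in sequentially. ennreal t < \<tau> n \<omega>" "\<forall>\<^sub>F n in sequentially. ennreal t < \<sigma> n \<omega>"
          by (auto intro: order_tendstoD(1))
        then show "\<forall>\<^sub>F n in sequentially. \<omega> \<notin> ?B n"
          by eventually_elim (auto simp: min_le_iff_disj)
      qed
    qed
    then have "\<forall>\<^sub>F n in sequentially. prob (?B n) < \<epsilon>" using \<epsilon> by (rule order_tendstoD(2))
    \<comment> \<open>The localization index is fixed before the grid; afterwards only the
      oscillation time depends on the number of cells.\<close>
    then obtain n where n: "prob (?B n) < \<epsilon>" by (auto simp: eventually_sequentially)
    define u where "u = (\<lambda>(k::nat) (j::nat). s + (t - s) * real j / real (Suc k))"
    have u0: "0 \<le> u k j" for k j
      unfolding u_def using st by (intro add_nonneg_nonneg divide_nonneg_nonneg mult_nonneg_nonneg) auto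
    have us: "u k 0 = s" and ut: "u k (Suc k) = t" for k by (simp_all add: u_def)
    have u_step: "u k (Suc j) = u k j + (t - s) * inverse (real (Suc k))" for k j
      unfolding u_def of_nat_Suc[of j]
      by (simp add: divide_inverse distrib_left distrib_right add_ac del: of_nat_Suc)
    have u_le: "u k j \<le> u k (Suc j)" for k j unfolding u_step using st by simp
    have u_mono: "u k i \<le> u k j" if "i \<le> j" for k i j
      using lift_Suc_mono_le[of "u k", OF u_le that] .
    let ?D = "\<lambda>k. {\<omega>\<in>space M. oscillation_time Z (u k) (Suc k) \<epsilon> \<omega> \<le> ennreal t}"
    have "\<forall>\<^sub>F k in sequentially. prob (?D k) < \<epsilon>"
      using order_tendstoD(2)[OF prob_oscillation_time_tendsto_0[OF ad cont st \<epsilon>] \<epsilon>] by (simp only: u_def)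
    moreover have "\<forall>\<^sub>F k in sequentially. \<forall>j<Suc k. q (u k (Suc j)) - q (u k j) \<le> \<epsilon>"
    proof -
      have "uniformly_continuous_on {s..t} q"
        by (intro compact_uniformly_continuous continuous_on_subset[OF q(1)]) (use st in auto)
      then obtain \<delta> where \<delta>: "0 < \<delta>" "\<And>x y. x \<in> {s..t} \<Longrightarrow> y \<in> {s..t} \<Longrightarrow> dist y x < \<delta> \<Longrightarrow> dist (q y) (q x) < \<epsilon>"
        using \<epsilon> unfolding uniformly_continuous_on_def by metis
      have "(\<lambda>k. (t - s) * inverse (real (Suc k))) \<longlonglongrightarrow> (t - s) * 0"
        by (intro tendsto_intros LIMSEQ_inverse_real_of_nat)
      then have "\<forall>\<^sub>F k in sequentially. (t - s) * inverse (real (Suc k)) < \<delta>"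
        using \<delta>(1) by (intro order_tendstoD(2)) auto
      then show ?thesis
      proof eventually_elim
        fix k assume k: "(t - s) * inverse (real (Suc k)) < \<delta>"
        show "\<forall>j<Suc k. q (u k (Suc j)) - q (u k j) \<le> \<epsilon>"
        proof (intro allI impI)
          fix j assume "j < Suc k"
          then have "u k 0 \<le> u k j" "u k (Suc j) \<le> u k (Suc k)" by (auto intro!: u_mono)
          then have "u k j \<in> {s..t}" "u k (Suc j) \<in> {s..t}" using u_le[of k j] unfolding us ut by auto
          moreover have "dist (u k (Suc j)) (u k j) < \<delta>"
            using k st unfolding u_step dist_real_def by simp
          ultimately show "q (u k (Suc j)) - q (u k j) \<le> \<epsilon>"
            using \<delta>(2) by (fastforce simp: dist_real_def)
        qed
      qed
    qed
    ultimately have "\<forall>\<^sub>F k in sequentially. prob (?D k) < \<epsilon> \<and> (\<forall>j<Suc k. q (u k (Suc j)) - q (u k j) \<le> \<epsilon>)"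
      by eventually_elim simp
    then obtain k where k: "prob (?D k) < \<epsilon>" "\<And>j. j < Suc k \<Longrightarrow> q (u k (Suc j)) - q (u k j) \<le> \<epsilon>"
      by (auto simp: eventually_sequentially)
    define R where "R = oscillation_time Z (u k) (Suc k) \<epsilon>"
    have R: "extended_stopping_time F R"
      unfolding R_def by (rule extended_stopping_time_oscillation_time[OF ad cont, of "u k", OF u0])
    have D: "?D k \<in> events"
      by (rule sets_F_subset[OF t0 extended_stopping_timeD(1)[OF R t0, unfolded R_def]])
    \<comment> \<open>The same minimum is reached on two routes: Z is first stopped at its \<tau>
      and Q at its \<sigma>, and each is then stopped at the minimum of the other two times.\<close>
    define \<rho> where "\<rho> \<omega> = min (\<tau> n \<omega>) (min (\<sigma> n \<omega>) (R \<omega>))" for \<omega>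
    define Y where "Y = stopped_process Z \<rho>"
    define V where "V v \<omega> = q (clip v (\<rho> \<omega>))" for v \<omega>
    have Y: "martingale M F Y"
      unfolding Y_def \<rho>_def
      by (rule localized_martingale_stopped[OF ad cont intZ0 \<tau>(3) extended_stopping_time_min[OF \<sigma>(1) R]])
    have "martingale M F (stopped_process Q (\<lambda>\<omega>. min (\<sigma> n \<omega>) (min (\<tau> n \<omega>) (R \<omega>))))"
      by (rule localized_martingale_stopped[OF adQ contQ intQ0 \<sigma>(3) extended_stopping_time_min[OF \<tau>(1) R]])
    moreover have "(\<lambda>\<omega>. min (\<sigma> n \<omega>) (min (\<tau> n \<omega>) (R \<omega>))) = \<rho>" by (simp add: fun_eq_iff \<rho>_def min.left_commute)
    moreover have "stopped_process Q \<rho> = (\<lambda>v \<omega>. (Y v \<omega>)\<^sup>2 - V v \<omega>)"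
      by (simp add: fun_eq_iff stopped_process_eq Q_def Y_def V_def)
    ultimately have YV: "martingale M F (\<lambda>v \<omega>. (Y v \<omega>)\<^sup>2 - V v \<omega>)" by simp
    have YM: "Y v \<in> borel_measurable M" if "0 \<le> v" for v
      using Y that by (auto simp: martingale_def)
    \<comment> \<open>Measurability of the stopped clock is read off from the two martingales, as
      Y^2 minus the compensated square.\<close>
    have V_int: "integrable M (V v)" if "0 \<le> v" for v
    proof (rule integrable_const_bound[where B="q v"])
      have "(\<lambda>\<omega>. (Y v \<omega>)\<^sup>2 - V v \<omega>) \<in> borel_measurable M" using YV that by (auto simp: martingale_def)
      then have "(\<lambda>\<omega>. (Y v \<omega>)\<^sup>2 - ((Y v \<omega>)\<^sup>2 - V v \<omega>)) \<in> borel_measurable M"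
        using YM[OF that] by measurable
      then show "V v \<in> borel_measurable M" by simp
      show "AE \<omega> in M. norm (V v \<omega>) \<le> q v"
        using q_mono[OF clip_nonneg clip_le[OF that]] q_mono[OF order_refl clip_nonneg] by (simp add: V_def q)
    qed
    \<comment> \<open>If \<rho> is not before x, then V and q agree at x and V is at most q at y;
      otherwise V is frozen from x on.\<close>
    have V_step: "V y \<omega> - V x \<omega> \<le> q y - q x" if "0 \<le> x" "x \<le> y" for x y \<omega>
    proof (cases "ennreal x \<le> \<rho> \<omega>")
      case True
      then show ?thesis
        using that q_mono[OF clip_nonneg clip_le, of y] by (simp add: V_def clip_eq_time)
    next
      case False
      then show ?thesis
        using that q_mono[of x y] clip_eq_clip[of x y "\<rho> \<omega>"] by (simp add: V_def)
    qed
    have Y_step: "AE \<omega> in M. \<bar>Y (u k (Suc j)) \<omega> - Y (u k j) \<omega>\<bar> \<le> \<epsilon>" if j: "j < Suc k" for j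
      using cont[unfolded continuous_process_def]
    proof eventually_elim
      fix \<omega> assume c: "continuous_on {0..} (\<lambda>t. Z t \<omega>)"
      show "\<bar>Y (u k (Suc j)) \<omega> - Y (u k j) \<omega>\<bar> \<le> \<epsilon>"
      proof (cases "ennreal (u k j) \<le> \<rho> \<omega>")
        case True
        let ?m = "clip (u k (Suc j)) (\<rho> \<omega>)"
        have cj: "clip (u k j) (\<rho> \<omega>) = u k j" using clip_eq_time[OF u0 True] .
        then have "?m \<in> {u k j..u k (Suc j)}"
          using clip_mono[OF u0 u_le, of k j "\<rho> \<omega>"] clip_le[OF u0] by simp
        moreover have "ennreal ?m \<le> R \<omega>"
          unfolding ennreal_clip \<rho>_def by (simp add: min.coboundedI2)
        ultimately have "\<bar>Z ?m \<omega> - Z (u k j) \<omega>\<bar> \<le> \<epsilon>"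
          unfolding R_def by (intro oscillation_before_oscillation_time[of Z \<omega> "u k", OF c u0 j]) (use \<epsilon> in auto)
        then show ?thesis by (simp add: Y_def stopped_process_eq cj)
      next
        case False
        then show ?thesis
          using clip_eq_clip[OF u0 u_le, of "\<rho> \<omega>" k j] \<epsilon> by (simp add: Y_def stopped_process_eq)
      qed
    qed
    have A': "A \<in> sets (F (u k 0))" using A us by simp
    let ?E = "?B n \<union> ?D k"
    have E: "?E \<in> events" using B D by blast
    have PE: "prob ?E \<le> 2 * \<epsilon>"
      using measure_Un_le[OF B D, of n] n k(1) by simp
    have stop: "clip v (\<rho> \<omega>) = v" if "\<omega> \<in> space M - ?E" "0 \<le> v" "v \<le> t" for \<omega> v
    proof (rule clip_eq_time[OF that(2)])
      have "ennreal t < \<rho> \<omega>" using that(1) by (auto simp: \<rho>_def R_def min_le_iff_disj not_le)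
      then show "ennreal v \<le> \<rho> \<omega>" using ennreal_leI[OF that(3)] by simp
    qed
    \<comment> \<open>Off the exceptional event V runs like q, and on it the increment of V is still
      nonnegative, so the loss is at most q t - q s there.\<close>
    have "q t - q s - (\<integral>\<omega>. V t \<omega> - V s \<omega> \<partial>M) \<le> (q t - q s) * prob ?E"
    proof -
      have "(\<integral>\<omega>. (q t - q s) - (q t - q s) * indicator ?E \<omega> \<partial>M) \<le> (\<integral>\<omega>. V t \<omega> - V s \<omega> \<partial>M)"
      proof (rule integral_mono)
        fix \<omega> assume \<omega>: "\<omega> \<in> space M"
        show "(q t - q s) - (q t - q s) * indicator ?E \<omega> \<le> V t \<omega> - V s \<omega>"
        proof (cases "\<omega> \<in> ?E")
          case True
          then show ?thesis
            using q_mono[OF clip_nonneg clip_mono[OF st, of "\<rho> \<omega>"]] by (simp add: V_def del: Un_iff)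
        next
          case False
          then show ?thesis using stop[of \<omega> s] stop[of \<omega> t] \<omega> st t0 by (simp add: V_def del: Un_iff)
        qed
      qed (use E V_int st t0 in \<open>auto simp: less_top[symmetric]\<close>)
      moreover have "(\<integral>\<omega>. (q t - q s) - (q t - q s) * indicator ?E \<omega> \<partial>M) = (q t - q s) - (q t - q s) * prob ?E"
        using E by (subst Bochner_Integration.integral_diff)
          (auto simp: prob_space Int_absorb2 sets.sets_into_space less_top[symmetric] simp del: Un_iff)
      ultimately show ?thesis by simp
    qed
    also have "\<dots> \<le> (q t - q s) * (2 * \<epsilon>)" by (rule mult_left_mono[OF PE qts])
    finally have V_defect: "q t - q s - (\<integral>\<omega>. V t \<omega> - V s \<omega> \<partial>M) \<le> (q t - q s) * (2 * \<epsilon>)" .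
    let ?LY = "\<integral>\<omega>. indicator A \<omega> * iexp (\<theta> * (Y t \<omega> - Y s \<omega>)) \<partial>M"
    note est = characteristic_estimate[where u="u k" and q=q and k="Suc k" and \<theta>=\<theta>, OF Y YV V_int u0 u_le Y_step AE_I2[OF V_step[OF u0 u_le]]
        q_mono[OF u0 u_le] k(2) A' order_refl]
    have "cmod (?LY - ?R) \<le> \<epsilon> * (\<bar>\<theta>\<bar>^3 / 6 + \<theta>^4 / 8) * (q t - q s) + \<theta>\<^sup>2 / 2 * (q t - q s - (\<integral>\<omega>. V t \<omega> - V s \<omega> \<partial>M))"
      using est unfolding us ut .
    also have "\<dots> \<le> \<epsilon> * (\<bar>\<theta>\<bar>^3 / 6 + \<theta>^4 / 8) * (q t - q s) + \<theta>\<^sup>2 / 2 * ((q t - q s) * (2 * \<epsilon>))"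
      by (intro add_left_mono mult_left_mono V_defect) auto
    finally have 1: "cmod (?LY - ?R) \<le> \<epsilon> * (\<bar>\<theta>\<bar>^3 / 6 + \<theta>^4 / 8) * (q t - q s) + \<theta>\<^sup>2 / 2 * ((q t - q s) * (2 * \<epsilon>))" .
    have AM: "A \<in> events" using A sets_F_subset[OF st(1)] by blast
    have "cmod (?L - ?LY) \<le> 2 * prob ?E"
    proof (rule norm_integral_diff_le_prob[OF _ _ _ _ E])
      note [measurable] = AM ZM[OF st(1)] ZM[OF t0] YM[OF st(1)] YM[OF t0]
      show "(\<lambda>\<omega>. indicator A \<omega> * iexp (\<theta> * (Z t \<omega> - Z s \<omega>))) \<in> borel_measurable M"
        "(\<lambda>\<omega>. indicator A \<omega> * iexp (\<theta> * (Y t \<omega> - Y s \<omega>))) \<in> borel_measurable M"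
        by measurable
      fix \<omega> assume "\<omega> \<in> space M - ?E"
      then show "indicator A \<omega> * iexp (\<theta> * (Z t \<omega> - Z s \<omega>)) = indicator A \<omega> * iexp (\<theta> * (Y t \<omega> - Y s \<omega>))"
        using stop[of \<omega> s] stop[of \<omega> t] st t0 by (simp add: Y_def stopped_process_eq del: Un_iff)
    qed (auto simp: norm_mult indicator_def)
    then have 2: "cmod (?L - ?LY) \<le> 4 * \<epsilon>" using PE by simp
    have "?L - ?R = (?L - ?LY) + (?LY - ?R)" by simp
    then have "cmod (?L - ?R) \<le> cmod (?L - ?LY) + cmod (?LY - ?R)"
      by (simp only: norm_triangle_ineq)
    also have "\<dots> \<le> 4 * \<epsilon> + (\<epsilon> * (\<bar>\<theta>\<bar>^3 / 6 + \<theta>^4 / 8) * (q t - q s) + \<theta>\<^sup>2 / 2 * ((q t - q s) * (2 * \<epsilon>)))"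
      using 1 2 by (rule add_mono[rotated])
    also have "\<dots> = \<epsilon> * C" by (simp add: C_def field_simps)
    finally show ?thesis .
  qed
  have "\<not> 0 < cmod (?L - ?R)"
  proof
    assume p: "0 < cmod (?L - ?R)"
    \<comment> \<open>With this choice of \<epsilon> the distance would be at most half of
      itself.\<close>
    then have "cmod (?L - ?R) \<le> cmod (?L - ?R) / (2 * C) * C" using C by (intro key) simp
    then show False using p C by simp
  qed
  then show ?thesis by simp
qed

end

section \<open>Law of the increments\<close>

lemma (in prob_space) integral_iexp_normal:
  assumes X: "distributed M lborel X (normal_density 0 \<sigma>)" and \<sigma>: "0 < \<sigma>"
  shows "(\<integral>\<omega>. iexp (\<theta> * X \<omega>) \<partial>M) = complex_of_real (exp (- (\<theta>\<^sup>2 * \<sigma>\<^sup>2 / 2)))"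
proof -
  have Xm: "X \<in> borel_measurable M" using distributed_measurable[OF X] by simp
  have "distributed M lborel (\<lambda>\<omega>. X \<omega> / \<sigma>) std_normal_density"
    using X unfolding normal_standard_normal_convert[OF \<sigma>] by simp
  then have D: "distr M lborel (\<lambda>\<omega>. X \<omega> / \<sigma>) = std_normal_distribution"
    by (rule distributed_distr_eq_density)
  have "(\<integral>\<omega>. iexp (\<theta> * X \<omega>) \<partial>M) = (\<integral>\<omega>. iexp ((\<theta> * \<sigma>) * (X \<omega> / \<sigma>)) \<partial>M)"
    using \<sigma> by simp
  also have "\<dots> = (\<integral>x. iexp ((\<theta> * \<sigma>) * x) \<partial>distr M lborel (\<lambda>\<omega>. X \<omega> / \<sigma>))"
    using Xm by (subst integral_distr) auto
  also have "\<dots> = char std_normal_distribution (\<theta> * \<sigma>)"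
    unfolding D char_def ..
  also have "\<dots> = complex_of_real (exp (- (\<theta>\<^sup>2 * \<sigma>\<^sup>2 / 2)))"
    by (simp add: char_std_normal_distribution power_mult_distrib)
  finally show ?thesis .
qed

text \<open>Under the probability conditioned on A, the law of X has the characteristic function of
  N, so the two laws agree by Levy's uniqueness theorem. If A is null, both sides are 0.\<close>

lemma (in prob_space) conditional_law_eqI:
  fixes X Y :: "'a \<Rightarrow> real"
  assumes X[measurable]: "X \<in> borel_measurable M" and Y: "real_distribution N"
    and A[measurable]: "A \<in> events" and B[measurable]: "B \<in> sets borel"
    and char: "\<And>\<theta>. (\<integral>\<omega>. indicator A \<omega> * iexp (\<theta> * X \<omega>) \<partial>M) = of_real (prob A) * char N \<theta>"
  shows "prob (A \<inter> (X -` B \<inter> space M)) = prob A * measure N B"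
proof (cases "prob A = 0")
  case True
  have "prob (A \<inter> (X -` B \<inter> space M)) \<le> prob A" by (rule finite_measure_mono) auto
  then show ?thesis using True measure_nonneg[of M "A \<inter> (X -` B \<inter> space M)"] by simp
next
  case False
  then have pos: "0 < prob A" by (simp add: zero_less_measure_iff)
  define U where "U = uniform_measure M A"
  have eA: "emeasure M A \<noteq> 0" "emeasure M A \<noteq> \<infinity>" using False by (auto simp: emeasure_eq_measure)
  interpret U: prob_space U unfolding U_def by (rule prob_space_uniform_measure[OF eA])
  have UX: "X \<in> borel_measurable U" by (simp add: U_def)
  have U: "U = density M (\<lambda>\<omega>. ennreal (indicator A \<omega> / prob A))"
    unfolding U_def uniform_measure_def
    using pos by (intro density_cong) (auto simp: emeasure_eq_measure divide_ennreal[symmetric] ennreal_indicator)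
  have "distr U borel X = N"
  proof (rule Levy_uniqueness[OF U.real_distribution_distr[OF UX] Y], rule ext)
    fix \<theta>
    have "char (distr U borel X) \<theta> = (\<integral>\<omega>. iexp (\<theta> * X \<omega>) \<partial>U)"
      unfolding char_def using UX by (subst integral_distr) auto
    also have "\<dots> = (\<integral>\<omega>. (indicator A \<omega> / prob A) *\<^sub>R iexp (\<theta> * X \<omega>) \<partial>M)"
      unfolding U by (rule integral_density) auto
    also have "\<dots> = (\<integral>\<omega>. (indicator A \<omega> * iexp (\<theta> * X \<omega>)) / prob A \<partial>M)"
      by (rule Bochner_Integration.integral_cong) (auto simp: scaleR_conv_of_real indicator_def)
    also have "\<dots> = (\<integral>\<omega>. (indicator A \<omega> * iexp (\<theta> * X \<omega>)) \<partial>M) / prob A"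
      by simp
    also have "\<dots> = char N \<theta>" unfolding char using False by simp
    finally show "char (distr U borel X) \<theta> = char N \<theta>" .
  qed
  then have "measure N B = measure (distr U borel X) B" by simp
  also have "\<dots> = measure U (X -` B \<inter> space M)"
    using UX by (subst measure_distr) (auto simp: U_def)
  also have "\<dots> = prob (A \<inter> (X -` B \<inter> space M)) / prob A"
    unfolding U_def by (rule measure_uniform_measure[OF eA]) measurable
  finally show ?thesis using False by simp
qed

lemma wiener_processD:
  assumes "wiener_process M W"
  shows "continuous_process M W" "AE \<omega> in M. W 0 \<omega> = 0"
    and "\<And>n t. 0 \<le> t 0 \<Longrightarrow> (\<And>i. i < n \<Longrightarrow> t i < t (Suc i)) \<Longrightarrow>
      prob_space.indep_vars M (\<lambda>_. borel) (\<lambda>i \<omega>. W (t (Suc i)) \<omega> - W (t i) \<omega>) {..<n}"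
    and "\<And>s t. 0 \<le> s \<Longrightarrow> s < t \<Longrightarrow> distributed M lborel (\<lambda>\<omega>. W t \<omega> - W s \<omega>) (normal_density 0 (sqrt (t - s)))"
  using assms by (simp_all add: wiener_process_def)

section \<open>Increments of Z compared with those of W under the clock q\<close>

locale deterministic_quadratic_variation = stochastic_basis M F
  for M :: "'a measure" and F +
  fixes Z :: "real \<Rightarrow> 'a \<Rightarrow> real" and q :: "real \<Rightarrow> real"
  assumes Z_continuous: "continuous_process M Z"
    and Z_local_martingale: "local_martingale M F Z"
    and Z_0: "AE \<omega> in M. Z 0 \<omega> = 0"
    and Z_quadratic_variation: "is_quadratic_variation M F Z (\<lambda>t \<omega>. q t)"
begin

text \<open>The clock does not depend on \<omega>, and in a probability space an almost sure
  statement without \<omega> simply holds.\<close>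

lemma q_continuous: "continuous_on {0..} q" and q_0: "q 0 = 0"
  and q_mono: "0 \<le> x \<Longrightarrow> x \<le> y \<Longrightarrow> q x \<le> q y"
  using Z_quadratic_variation unfolding is_quadratic_variation_def continuous_process_def mono_on_def
  by simp_all

lemma q_nonneg: "0 \<le> x \<Longrightarrow> 0 \<le> q x"
  using q_mono[of 0 x] q_0 by simp

lemma Z_adapted: "0 \<le> t \<Longrightarrow> Z t \<in> borel_measurable (F t)"
  using Z_local_martingale by (simp add: local_martingale_def adapted_process_def)

lemma Z_measurable: "0 \<le> t \<Longrightarrow> Z t \<in> borel_measurable M"
  by (rule measurable_F_M[OF _ Z_adapted])

lemmas increment_char = increment_characteristic_function[OF Z_continuous Z_local_martingale Z_0 Z_quadratic_variation]

text \<open>X is any variable with the right normal law and later an increment of W, so Z and W are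
  compared directly. Strictness of q s < q t keeps the standard deviation positive.\<close>

lemma increment_independent_law:
  assumes X: "distributed M lborel X (normal_density 0 (sqrt (q t - q s)))"
    and st: "0 \<le> s" "s \<le> t" "q s < q t" and A: "A \<in> sets (F s)" and B: "B \<in> sets borel"
  shows "prob (A \<inter> ((\<lambda>\<omega>. Z t \<omega> - Z s \<omega>) -` B \<inter> space M)) = prob A * prob (X -` B \<inter> space M)"
proof -
  have t0: "0 \<le> t" using st by simp
  have X': "X \<in> borel_measurable M" using distributed_measurable[OF X] by simp
  have "prob (A \<inter> ((\<lambda>\<omega>. Z t \<omega> - Z s \<omega>) -` B \<inter> space M)) = prob A * measure (distr M borel X) B"
  proof (rule conditional_law_eqI[OF _ real_distribution_distr[OF X'] _ B])
    show "(\<lambda>\<omega>. Z t \<omega> - Z s \<omega>) \<in> borel_measurable M"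
      using Z_measurable[OF st(1)] Z_measurable[OF t0] by simp
    show "A \<in> events" using A sets_F_subset[OF st(1)] by blast
    fix \<theta>
    have "char (distr M borel X) \<theta> = (\<integral>\<omega>. iexp (\<theta> * X \<omega>) \<partial>M)"
      unfolding char_def using X' by (subst integral_distr) auto
    also have "\<dots> = complex_of_real (exp (- (\<theta>\<^sup>2 * (q t - q s) / 2)))"
      using integral_iexp_normal[OF X, of \<theta>] st(3) by simp
    finally show "(\<integral>\<omega>. indicator A \<omega> * iexp (\<theta> * (Z t \<omega> - Z s \<omega>)) \<partial>M) = of_real (prob A) * char (distr M borel X) \<theta>"
      using increment_char[OF st(1,2) A, of \<theta>] by simp
  qed
  then show ?thesis using X' B by (simp add: measure_distr)
qed

text \<open>If q does not grow, the characteristic function of the increment is constantly 1, which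
  is that of the point mass at 0.\<close>

lemma AE_constant_on_flat_pieces:
  assumes st: "0 \<le> s" "s \<le> t" and eq: "q s = q t"
  shows "AE \<omega> in M. Z t \<omega> = Z s \<omega>"
proof -
  have t0: "0 \<le> t" using st by simp
  have [measurable]: "Z s \<in> borel_measurable M" "Z t \<in> borel_measurable M"
    using Z_measurable st t0 by auto
  have sp: "space M \<in> sets (F s)" using space_F[OF st(1)] by (metis sets.top)
  have N: "real_distribution (return borel (0::real))"
    by (simp add: real_distribution_def real_distribution_axioms_def prob_space_return)
  have "prob (space M \<inter> ((\<lambda>\<omega>. Z t \<omega> - Z s \<omega>) -` {0} \<inter> space M)) = prob (space M) * measure (return borel (0::real)) {0}"
  proof (rule conditional_law_eqI[OF _ N])
    fix \<theta>
    have "char (return borel (0::real)) \<theta> = 1"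
      unfolding char_def by (subst integral_return) auto
    then show "(\<integral>\<omega>. indicator (space M) \<omega> * iexp (\<theta> * (Z t \<omega> - Z s \<omega>)) \<partial>M) = of_real (prob (space M)) * char (return borel 0) \<theta>"
      using increment_char[OF st sp, of \<theta>] eq by simp
  qed auto
  moreover have "space M \<inter> ((\<lambda>\<omega>. Z t \<omega> - Z s \<omega>) -` {0} \<inter> space M) = {\<omega>\<in>space M. Z t \<omega> = Z s \<omega>}"
    by auto
  ultimately have "prob {\<omega>\<in>space M. Z t \<omega> = Z s \<omega>} = 1"
    by (simp add: prob_space measure_return)
  from AE_prob_1[OF this] show ?thesis by eventually_elim simp
qed

text \<open>The conditions on the first m increments define an event of \<open>F (v m)\<close>, so
  the next increment splits off as a factor; induction on m.\<close>

lemma increment_box_prob: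
  assumes W: "wiener_process M W"
    and v0: "0 \<le> v 0" and v: "\<And>i. i < n \<Longrightarrow> v i \<le> v (Suc i)" and qv: "\<And>i. i < n \<Longrightarrow> q (v i) < q (v (Suc i))"
    and B: "\<And>i. i < n \<Longrightarrow> B i \<in> sets borel"
  shows "prob {\<omega>\<in>space M. \<forall>i<n. Z (v (Suc i)) \<omega> - Z (v i) \<omega> \<in> B i} =
      (\<Prod>i<n. prob ((\<lambda>\<omega>. W (q (v (Suc i))) \<omega> - W (q (v i)) \<omega>) -` B i \<inter> space M))"
proof -
  define E where "E m = {\<omega>\<in>space M. \<forall>i<m. Z (v (Suc i)) \<omega> - Z (v i) \<omega> \<in> B i}" for m
  have v_nonneg: "m \<le> n \<Longrightarrow> 0 \<le> v m" for m
  proof (induction m)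
    case (Suc m)
    then show ?case using v[of m] by simp
  qed (rule v0)
  have "m \<le> n \<Longrightarrow> E m \<in> sets (F (v m)) \<and>
    prob (E m) = (\<Prod>i<m. prob ((\<lambda>\<omega>. W (q (v (Suc i))) \<omega> - W (q (v i)) \<omega>) -` B i \<inter> space M))" for m
  proof (induction m)
    case 0
    have "E 0 = space (F (v 0))" using space_F[OF v0] by (simp add: E_def)
    then have "E 0 \<in> sets (F (v 0))" by (simp only: sets.top)
    moreover have "E 0 = space M" by (simp add: E_def)
    ultimately show ?case by (simp add: prob_space)
  next
    case (Suc m)
    then have m: "m < n" and IH: "E m \<in> sets (F (v m))"
      "prob (E m) = (\<Prod>i<m. prob ((\<lambda>\<omega>. W (q (v (Suc i))) \<omega> - W (q (v i)) \<omega>) -` B i \<inter> space M))" by auto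
    have vm: "0 \<le> v m" "v m \<le> v (Suc m)" "q (v m) < q (v (Suc m))" "0 \<le> v (Suc m)"
      using v_nonneg[of m] v_nonneg[of "Suc m"] v[OF m] qv[OF m] m by auto
    have split: "E (Suc m) = E m \<inter> ((\<lambda>\<omega>. Z (v (Suc m)) \<omega> - Z (v m) \<omega>) -` B m \<inter> space M)"
      by (auto simp: E_def less_Suc_eq)
    have "E m \<in> sets (F (v (Suc m)))" using IH(1) F_mono[OF vm(1,2)] by blast
    moreover have "(\<lambda>\<omega>. Z (v (Suc m)) \<omega> - Z (v m) \<omega>) -` B m \<inter> space M \<in> sets (F (v (Suc m)))"
      unfolding space_F[OF vm(4), symmetric]
      by (rule measurable_sets[OF borel_measurable_diff[OF Z_adapted[OF vm(4)] measurable_F_mono[OF vm(1,2) Z_adapted[OF vm(1)]]] B[OF m]])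
    ultimately have 1: "E (Suc m) \<in> sets (F (v (Suc m)))" unfolding split by (rule sets.Int)
    have "prob (E (Suc m)) = prob (E m) * prob ((\<lambda>\<omega>. W (q (v (Suc m))) \<omega> - W (q (v m)) \<omega>) -` B m \<inter> space M)"
      unfolding split
      by (rule increment_independent_law[OF wiener_processD(4)[OF W q_nonneg[OF vm(1)] vm(3)] vm(1,2,3) IH(1) B[OF m]])
    then show ?case using 1 IH(2) by (simp add: mult.commute)
  qed
  from this[OF order_refl] show ?thesis unfolding E_def by (rule conjunct2)
qed

text \<open>Boxes generate the product space and are closed under intersection. On a box both laws
  are the same product of one-dimensional probabilities, for Z by splitting off increments one by
  one and for W by independence.\<close>

lemma increments_same_law:
  assumes W: "wiener_process M W" and Wm: "\<And>t. 0 \<le> t \<Longrightarrow> W t \<in> borel_measurable M"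
    and v0: "0 \<le> v 0" and v: "\<And>i. i < n \<Longrightarrow> v i \<le> v (Suc i)" and qv: "\<And>i. i < n \<Longrightarrow> q (v i) < q (v (Suc i))"
  shows "distr M (PiM {..<n} (\<lambda>_. borel)) (\<lambda>\<omega>. \<lambda>i\<in>{..<n}. Z (v (Suc i)) \<omega> - Z (v i) \<omega>) =
    distr M (PiM {..<n} (\<lambda>_. borel)) (\<lambda>\<omega>. \<lambda>i\<in>{..<n}. W (q (v (Suc i))) \<omega> - W (q (v i)) \<omega>)"
    (is "distr M ?P ?Z = distr M ?P ?W")
proof -
  have v_nonneg: "m \<le> n \<Longrightarrow> 0 \<le> v m" for m
  proof (induction m)
    case (Suc m)
    then show ?case using v[of m] by simp
  qed (rule v0)
  have Z: "?Z \<in> measurable M ?P"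
    by (intro measurable_restrict borel_measurable_diff Z_measurable v_nonneg) auto
  have W': "?W \<in> measurable M ?P"
    by (intro measurable_restrict borel_measurable_diff Wm q_nonneg v_nonneg) auto
  show ?thesis
  proof (rule measure_eqI_PiM_finite[where I="{..<n}" and M="\<lambda>_. borel" and A="\<lambda>_. space ?P"])
    fix B :: "nat \<Rightarrow> real set" assume B: "\<And>i. i \<in> {..<n} \<Longrightarrow> B i \<in> sets borel"
    then have PB: "Pi\<^sub>E {..<n} B \<in> sets ?P" by (rule sets_PiM_I_finite[OF finite_lessThan])
    have "?Z -` Pi\<^sub>E {..<n} B \<inter> space M = {\<omega>\<in>space M. \<forall>i<n. Z (v (Suc i)) \<omega> - Z (v i) \<omega> \<in> B i}"
      unfolding vimage_def restrict_PiE_iff Ball_def lessThan_iff by blast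
    then have "prob (?Z -` Pi\<^sub>E {..<n} B \<inter> space M) = (\<Prod>i<n. prob ((\<lambda>\<omega>. W (q (v (Suc i))) \<omega> - W (q (v i)) \<omega>) -` B i \<inter> space M))"
      using increment_box_prob[OF W v0 v qv B] by simp
    also have "\<dots> = prob {\<omega>\<in>space M. \<forall>i<n. W (q (v (Suc i))) \<omega> - W (q (v i)) \<omega> \<in> B i}"
    \<comment> \<open>An intersection over no index would be the whole type instead of
      \<open>space M\<close>.\<close>
    proof (cases "n = 0")
      case True
      then show ?thesis by (simp add: prob_space)
    next
      case False
      have "indep_vars (\<lambda>_. borel) (\<lambda>i \<omega>. W (q (v (Suc i))) \<omega> - W (q (v i)) \<omega>) {..<n}"
        by (rule wiener_processD(3)[OF W, of "\<lambda>i. q (v i)"]) (use q_nonneg[OF v0] qv in auto)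
      from indep_varsD_finite[OF this _ _ B] False
      have "(\<Prod>i<n. prob ((\<lambda>\<omega>. W (q (v (Suc i))) \<omega> - W (q (v i)) \<omega>) -` B i \<inter> space M)) =
        prob (\<Inter>i\<in>{..<n}. (\<lambda>\<omega>. W (q (v (Suc i))) \<omega> - W (q (v i)) \<omega>) -` B i \<inter> space M)" by auto
      also have "(\<Inter>i\<in>{..<n}. (\<lambda>\<omega>. W (q (v (Suc i))) \<omega> - W (q (v i)) \<omega>) -` B i \<inter> space M) = {\<omega>\<in>space M. \<forall>i<n. W (q (v (Suc i))) \<omega> - W (q (v i)) \<omega> \<in> B i}"
        using False by auto
      finally show ?thesis .
    qed
    also have "{\<omega>\<in>space M. \<forall>i<n. W (q (v (Suc i))) \<omega> - W (q (v i)) \<omega> \<in> B i} = ?W -` Pi\<^sub>E {..<n} B \<inter> space M"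
      unfolding vimage_def restrict_PiE_iff Ball_def lessThan_iff by blast
    finally show "emeasure (distr M ?P ?Z) (Pi\<^sub>E {..<n} B) = emeasure (distr M ?P ?W) (Pi\<^sub>E {..<n} B)"
      by (simp only: emeasure_distr[OF Z PB] emeasure_distr[OF W' PB] emeasure_eq_measure)
  next
    have "space ?P \<in> prod_algebra {..<n} (\<lambda>_. borel)"
      unfolding space_PiM by (rule prod_algebraI_finite) auto
    then show "range (\<lambda>_::nat. space ?P) \<subseteq> prod_algebra {..<n} (\<lambda>_. borel)" by auto
    show "emeasure (distr M ?P ?Z) (space ?P) \<noteq> \<infinity>"
      unfolding emeasure_distr[OF Z sets.top] emeasure_eq_measure by (rule ennreal_neq_top[folded infinity_ennreal_def])
    show "(\<Union>i::nat. space ?P) = space ?P" by (simp only: UN_constant UNIV_not_empty if_False)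
  qed (rule finite_lessThan sets_distr)+
qed

end

section \<open>Crossing probabilities\<close>

text \<open>The exit set is closed and the path continuous, so the infimum is attained. The maximum
  merges both barriers into one real function reaching level 0, the form required by
  \<open>reaches_iff_interval_grid\<close>.\<close>

lemma first_passage_time_le_iff:
  assumes cont: "continuous_on {0..} (\<lambda>t. X t \<omega>)" and t: "0 \<le> t"
  shows "first_passage_time X g h \<omega> \<le> ennreal t \<longleftrightarrow> (\<exists>u\<in>{0..t}. 0 \<le> max (X u \<omega> - g) (h - X u \<omega>))"
proof
  define C where "C = {u. 0 \<le> u \<and> (X u \<omega> \<ge> g \<or> X u \<omega> \<le> h)}"
  have fp: "first_passage_time X g h \<omega> = Inf (ennreal ` C)"
    unfolding first_passage_time_def C_def by (simp only: setcompr_eq_image)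
  assume le: "first_passage_time X g h \<omega> \<le> ennreal t"
  have "closed ({0..} \<inter> (\<lambda>u. X u \<omega>) -` ({g..} \<union> {..h}))"
    by (rule continuous_closed_preimage[OF cont]) auto
  moreover have "C = {0..} \<inter> (\<lambda>u. X u \<omega>) -` ({g..} \<union> {..h})" by (auto simp: C_def)
  ultimately have "closed C" by simp
  have "C \<noteq> {}" using le fp by (auto simp: top_unique)
  have bdd: "bdd_below C" unfolding bdd_below_def C_def by blast
  have I: "Inf C \<in> C" by (rule closed_contains_Inf[OF \<open>C \<noteq> {}\<close> bdd \<open>closed C\<close>])
  have "ennreal (Inf C) \<le> Inf (ennreal ` C)"
    using cInf_lower[OF _ bdd] by (auto intro!: INF_greatest ennreal_leI)
  then have "ennreal (Inf C) \<le> ennreal t" using le fp by simp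
  then have "Inf C \<le> t" using t by (simp add: ennreal_le_iff)
  then show "\<exists>u\<in>{0..t}. 0 \<le> max (X u \<omega> - g) (h - X u \<omega>)"
    using I by (intro bexI[of _ "Inf C"]) (auto simp: C_def max_def)
next
  assume "\<exists>u\<in>{0..t}. 0 \<le> max (X u \<omega> - g) (h - X u \<omega>)"
  then obtain u where u: "0 \<le> u" "u \<le> t" "g \<le> X u \<omega> \<or> X u \<omega> \<le> h"
    by (auto simp: max_def split: if_splits)
  then have "first_passage_time X g h \<omega> \<le> ennreal u"
    unfolding first_passage_time_def by (intro Inf_lower CollectI exI[of _ u] conjI refl)
  then show "first_passage_time X g h \<omega> \<le> ennreal t"
    using u(2) ennreal_leI order.trans by blast
qed

context stochastic_basis
begin

lemma crossing_probability_eq_grid: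
  assumes cont: "continuous_process M X" and X: "\<And>u. 0 \<le> u \<Longrightarrow> X u \<in> borel_measurable M" and t: "0 \<le> t"
  shows "{\<omega>\<in>space M. first_passage_time X g h \<omega> \<le> ennreal t} \<in> events"
    and "crossing_probability M X g h t =
      prob {\<omega>\<in>space M. \<forall>n. \<exists>w\<in>interval_grid 0 t. - (1 / real (Suc n)) < max (X w \<omega> - g) (h - X w \<omega>)}"
proof -
  let ?A = "{\<omega>\<in>space M. first_passage_time X g h \<omega> \<le> ennreal t}"
  let ?B = "{\<omega>\<in>space M. \<forall>n. \<exists>w\<in>interval_grid 0 t. - (1 / real (Suc n)) < max (X w \<omega> - g) (h - X w \<omega>)}"
  have B: "?B \<in> events"
  proof (intro sets.sets_Collect_countable_All sets.sets_Collect_countable_Ex' countable_interval_grid)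
    fix n w assume "w \<in> interval_grid 0 t"
    then have [measurable]: "X w \<in> borel_measurable M" using X interval_grid_subset[OF t] by auto
    show "{\<omega>\<in>space M. - (1 / real (Suc n)) < max (X w \<omega> - g) (h - X w \<omega>)} \<in> events" by measurable
  qed
  have ae: "AE \<omega> in M. \<omega> \<in> ?B \<longleftrightarrow> \<omega> \<in> ?A"
    using cont[unfolded continuous_process_def]
  proof eventually_elim
    fix \<omega> assume c: "continuous_on {0..} (\<lambda>t. X t \<omega>)"
    have "continuous_on {0..t} (\<lambda>u. max (X u \<omega> - g) (h - X u \<omega>))"
      by (intro continuous_intros continuous_on_subset[OF c]) auto
    from reaches_iff_interval_grid[OF this t, of 0] first_passage_time_le_iff[of X, OF c t, of g h]
    show "\<omega> \<in> ?B \<longleftrightarrow> \<omega> \<in> ?A" by simp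
  qed
  show A: "?A \<in> events" by (rule in_sets_AE[OF ae B]) blast
  show "crossing_probability M X g h t = prob ?B"
    unfolding crossing_probability_def by (rule measure_eq_AE[OF _ A B]) (use ae in eventually_elim, simp only:)
qed

text \<open>Up to a null set the crossing event is a decreasing intersection over the tolerances 1 /
  (n + 1) of increasing unions over finite sets of grid times. Continuity of the measure, applied in
  both directions, reduces equality to finitely many times.\<close>

lemma crossing_probability_cong:
  assumes X: "continuous_process M X" "\<And>u. 0 \<le> u \<Longrightarrow> X u \<in> borel_measurable M"
    and Y: "continuous_process M Y" "\<And>u. 0 \<le> u \<Longrightarrow> Y u \<in> borel_measurable M" and t: "0 \<le> t"
    and eq: "\<And>I G. finite I \<Longrightarrow> 0 \<in> I \<Longrightarrow> I \<subseteq> {0..} \<Longrightarrow> G \<in> sets borel \<Longrightarrow>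
      prob {\<omega>\<in>space M. \<exists>u\<in>I. X u \<omega> \<in> G} = prob {\<omega>\<in>space M. \<exists>u\<in>I. Y u \<omega> \<in> G}"
  shows "crossing_probability M X g h t = crossing_probability M Y g h t"
proof -
  define D where "D = interval_grid 0 t"
  define d where "d = from_nat_into D"
  \<comment> \<open>Finite pieces of an enumeration of the grid. Time 0 always belongs to them,
    since \<open>reach_prob_eq\<close> anchors the increments there.\<close>
  define I where "I k = insert 0 (d ` {..<k})" for k :: nat
  define G where "G n = {x. - (1 / real (Suc n)) < max (x - g) (h - x)}" for n
  define A where "A U n = {\<omega>\<in>space M. \<exists>w\<in>D. U w \<omega> \<in> G n}" for U :: "real \<Rightarrow> 'a \<Rightarrow> real" and n
  define A' where "A' U n k = {\<omega>\<in>space M. \<exists>w\<in>I k. U w \<omega> \<in> G n}" for U :: "real \<Rightarrow> 'a \<Rightarrow> real" and n k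
  have D0: "0 \<in> D" unfolding D_def interval_grid_def by (auto intro!: image_eqI[of _ _ "(0, 0)"])
  then have "D \<noteq> {}" by blast
  have D: "D = range d"
    unfolding d_def by (rule range_from_nat_into[OF \<open>D \<noteq> {}\<close>, symmetric]) (simp add: D_def countable_interval_grid)
  have D_sub: "D \<subseteq> {0..}" using interval_grid_subset[OF t] by (auto simp: D_def)
  have I: "finite (I k)" "0 \<in> I k" "I k \<subseteq> D" for k using D D0 by (auto simp: I_def)
  have UI: "(\<Union>k. I k) = D"
  proof
    show "D \<subseteq> (\<Union>k. I k)"
    proof
      fix w assume "w \<in> D"
      then obtain j where "w = d j" using D by blast
      then have "w \<in> I (Suc j)" by (simp add: I_def)
      then show "w \<in> (\<Union>k. I k)" by blast
    qed
  qed (use I in blast)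
  have G: "G n \<in> sets borel" for n
  proof -
    have "(\<lambda>x. max (x - g) (h - x)) \<in> borel_measurable borel" by measurable
    then have "{x\<in>space borel. - (1 / real (Suc n)) < max (x - g) (h - x)} \<in> sets borel" by measurable
    then show ?thesis by (simp add: G_def)
  qed
  have G_anti: "G (Suc n) \<subseteq> G n" for n
  proof
    fix x assume "x \<in> G (Suc n)"
    moreover have "1 / real (Suc (Suc n)) \<le> 1 / real (Suc n)" by (simp add: frac_le)
    ultimately show "x \<in> G n" unfolding G_def by (simp only: mem_Collect_eq)
  qed
  have meas: "A' U n k \<in> events" "A U n \<in> events" if U: "\<And>u. 0 \<le> u \<Longrightarrow> U u \<in> borel_measurable M" for U n k
  proof -
    have "{\<omega>\<in>space M. U w \<omega> \<in> G n} \<in> events" if "w \<in> D" for w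
    proof -
      have "U w -` G n \<inter> space M \<in> events" using U D_sub that by (intro measurable_sets[OF _ G]) auto
      then show ?thesis by (simp only: vimage_def Int_def mem_Collect_eq conj_commute)
    qed
    note w = this
    show "A' U n k \<in> events"
      unfolding A'_def using w I(3) by (intro sets.sets_Collect_countable_Ex' countable_finite[OF I(1)]) blast
    show "A U n \<in> events"
      unfolding A_def using w
      by (intro sets.sets_Collect_countable_Ex' countable_interval_grid[of 0 t, folded D_def])
  qed
  have lim1: "(\<lambda>k. prob (A' U n k)) \<longlonglongrightarrow> prob (A U n)" if U: "\<And>u. 0 \<le> u \<Longrightarrow> U u \<in> borel_measurable M" for U n
  proof -
    have "(\<lambda>k. prob (A' U n k)) \<longlonglongrightarrow> prob (\<Union>k. A' U n k)"
    proof (rule finite_Lim_measure_incseq)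
      show "range (A' U n) \<subseteq> events" by (intro image_subsetI meas(1)) (rule U)
      have "I k \<subseteq> I (Suc k)" for k by (auto simp: I_def)
      then show "incseq (A' U n)" unfolding incseq_Suc_iff A'_def by blast
    qed
    also have "(\<Union>k. A' U n k) = A U n" unfolding A_def A'_def UI[symmetric] by blast
    finally show ?thesis .
  qed
  have lim2: "(\<lambda>n. prob (A U n)) \<longlonglongrightarrow> prob (\<Inter>n. A U n)" if U: "\<And>u. 0 \<le> u \<Longrightarrow> U u \<in> borel_measurable M" for U
  proof (rule finite_Lim_measure_decseq)
    show "range (A U) \<subseteq> events" by (intro image_subsetI meas(2)) (rule U)
    show "decseq (A U)" unfolding decseq_Suc_iff A_def using G_anti by blast
  qed
  have cross: "crossing_probability M U g h t = prob (\<Inter>n. A U n)"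
    if U: "continuous_process M U" "\<And>u. 0 \<le> u \<Longrightarrow> U u \<in> borel_measurable M" for U
  proof -
    have "(\<Inter>n. A U n) = {\<omega>\<in>space M. \<forall>n. \<exists>w\<in>interval_grid 0 t. - (1 / real (Suc n)) < max (U w \<omega> - g) (h - U w \<omega>)}"
      unfolding A_def G_def D_def by blast
    then show ?thesis by (simp only: crossing_probability_eq_grid(2)[OF U t])
  qed
  have "prob (A' X n k) = prob (A' Y n k)" for n k
    unfolding A'_def by (intro eq G I(1,2) order.trans[OF I(3) D_sub])
  then have "(\<lambda>k. prob (A' Y n k)) \<longlonglongrightarrow> prob (A X n)" for n
    using lim1[of X n] X(2) by simp
  moreover have "(\<lambda>k. prob (A' Y n k)) \<longlonglongrightarrow> prob (A Y n)" for n
    by (rule lim1) (rule Y(2))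
  ultimately have "prob (A X n) = prob (A Y n)" for n
    by (rule LIMSEQ_unique)
  then have "(\<lambda>n. prob (A Y n)) \<longlonglongrightarrow> prob (\<Inter>n. A X n)"
    using lim2[of X] X(2) by simp
  moreover have "(\<lambda>n. prob (A Y n)) \<longlonglongrightarrow> prob (\<Inter>n. A Y n)"
    by (rule lim2) (rule Y(2))
  ultimately have "prob (\<Inter>n. A X n) = prob (\<Inter>n. A Y n)"
    by (rule LIMSEQ_unique)
  then show ?thesis by (simp only: cross[OF X] cross[OF Y])
qed

end

context deterministic_quadratic_variation
begin

text \<open>
  The increments of \<open>W\<close> are controlled only over strictly increasing times, so times in \<open>I\<close> with the
  same clock value are represented by a single one, chosen by \<open>p\<close>.
\<close>

lemma reach_prob_eq:
  assumes W: "wiener_process M W" and Wm: "\<And>t. 0 \<le> t \<Longrightarrow> W t \<in> borel_measurable M"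
    and I: "finite I" "0 \<in> I" "I \<subseteq> {0..}" and G: "G \<in> sets borel"
  shows "prob {\<omega>\<in>space M. \<exists>u\<in>I. Z u \<omega> \<in> G} = prob {\<omega>\<in>space M. \<exists>u\<in>I. W (q u) \<omega> \<in> G}"
proof -
  define S where "S = q ` I"
  have "\<forall>r\<in>S. \<exists>u\<in>I. q u = r" by (auto simp: S_def)
  then obtain p where p: "\<And>r. r \<in> S \<Longrightarrow> p r \<in> I" "\<And>r. r \<in> S \<Longrightarrow> q (p r) = r" by metis
  have S: "finite S" "0 \<in> S" using I q_0 by (auto simp: S_def intro: image_eqI[of _ _ 0])
  have S_nonneg: "0 \<le> r" if "r \<in> S" for r using that I q_nonneg by (auto simp: S_def)
  define xs where "xs = sorted_list_of_set S"
  \<comment> \<open>There are n + 1 clock values and hence n increments; S is nonempty, so the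
    truncated subtraction is exact.\<close>
  define n where "n = card S - 1"
  define v where "v i = p (xs ! i)" for i
  have set_xs: "set xs = S" and len: "length xs = Suc n"
  proof -
    have "0 < card S" using S card_gt_0_iff by blast
    then show "length xs = Suc n" by (simp add: xs_def n_def)
    show "set xs = S" using S by (simp add: xs_def)
  qed
  have strict: "xs ! i < xs ! j" if "i < j" "j < Suc n" for i j
    using strict_sorted_list_of_set[of S, folded xs_def] that(1) by (rule sorted_wrt_nth_less) (simp add: that len)
  have xs_in: "xs ! i \<in> S" if "i < Suc n" for i using that len set_xs nth_mem by metis
  obtain k where k: "k < Suc n" "xs ! k = 0" using S(2) len set_xs by (metis in_set_conv_nth)
  have xs0: "xs ! 0 = 0"
  proof (cases "k = 0")
    case False
    then have "xs ! 0 < 0" using strict[of 0 k] k by simp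
    then show ?thesis using S_nonneg[OF xs_in[of 0]] by simp
  qed (use k in simp)
  have qv: "q (v i) = xs ! i" and v_nonneg: "0 \<le> v i" if "i < Suc n" for i
    using p[OF xs_in[OF that]] I(3) by (auto simp: v_def)
  have q_less: "q (v i) < q (v (Suc i))" if "i < n" for i
    using strict[of i "Suc i"] qv[of i] qv[of "Suc i"] that by simp
  have v_le: "v i \<le> v (Suc i)" if i: "i < n" for i
  proof (rule ccontr)
    assume "\<not> v i \<le> v (Suc i)"
    then have "q (v (Suc i)) \<le> q (v i)" using v_nonneg[of "Suc i"] i by (intro q_mono) auto
    then show False using q_less[OF i] by simp
  qed
  let ?P = "PiM {..<n} (\<lambda>_. borel) :: (nat \<Rightarrow> real) measure"
  \<comment> \<open>The event in terms of increments alone. The empty sum for j = 0 stands for the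
    starting value 0, which may itself lie in G.\<close>
  define T where "T = {x\<in>space ?P. \<exists>j\<in>{..n}. (\<Sum>i<j. x i) \<in> G}"
  have T: "T \<in> sets ?P"
    unfolding T_def
  proof (intro sets.sets_Collect_finite_Ex finite_atMost)
    fix j assume j: "j \<in> {..n}"
    have "(\<lambda>x. \<Sum>i<j. x i) \<in> borel_measurable ?P"
      using j by (intro borel_measurable_sum measurable_component_singleton) auto
    from measurable_sets[OF this G] show "{x\<in>space ?P. (\<Sum>i<j. x i) \<in> G} \<in> sets ?P"
      by (simp only: vimage_def Int_def mem_Collect_eq conj_commute)
  qed
  have law: "prob {\<omega>\<in>space M. \<exists>j\<in>{..n}. U j \<omega> - U 0 \<omega> \<in> G} =
      measure (distr M ?P (\<lambda>\<omega>. \<lambda>i\<in>{..<n}. U (Suc i) \<omega> - U i \<omega>)) T"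
    if U: "\<And>i. i < Suc n \<Longrightarrow> U i \<in> borel_measurable M" for U :: "nat \<Rightarrow> 'a \<Rightarrow> real"
  proof -
    let ?U = "\<lambda>\<omega>. \<lambda>i\<in>{..<n}. U (Suc i) \<omega> - U i \<omega>"
    have Um: "?U \<in> measurable M ?P"
      by (intro measurable_restrict borel_measurable_diff U) auto
    have tele: "(\<Sum>i<j. ?U \<omega> i) = U j \<omega> - U 0 \<omega>" if "j \<in> {..n}" for j \<omega>
    proof -
      have "(\<Sum>i<j. ?U \<omega> i) = (\<Sum>i<j. U (Suc i) \<omega> - U i \<omega>)" using that by (intro sum.cong) auto
      then show ?thesis using sum_lessThan_telescope[of "\<lambda>i. U i \<omega>" j] by simp
    qed
    have "?U -` T \<inter> space M = {\<omega>\<in>space M. \<exists>j\<in>{..n}. U j \<omega> - U 0 \<omega> \<in> G}"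
    proof (rule set_eqI)
      fix \<omega>
      have "\<omega> \<in> ?U -` T \<inter> space M \<longleftrightarrow> \<omega> \<in> space M \<and> (\<exists>j\<in>{..n}. (\<Sum>i<j. ?U \<omega> i) \<in> G)"
        using measurable_space[OF Um] unfolding T_def by blast
      also have "\<dots> \<longleftrightarrow> \<omega> \<in> {\<omega>\<in>space M. \<exists>j\<in>{..n}. U j \<omega> - U 0 \<omega> \<in> G}"
        by (simp only: tele mem_Collect_eq cong: bex_cong)
      finally show "\<omega> \<in> ?U -` T \<inter> space M \<longleftrightarrow> \<omega> \<in> {\<omega>\<in>space M. \<exists>j\<in>{..n}. U j \<omega> - U 0 \<omega> \<in> G}" .
    qed
    then show ?thesis by (simp only: measure_distr[OF Um T])
  qed
  have reach_meas: "{\<omega>\<in>space M. \<exists>j\<in>J. U j \<omega> \<in> G} \<in> events"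
    if "finite J" "\<And>j. j \<in> J \<Longrightarrow> U j \<in> borel_measurable M" for J :: "'c set" and U :: "'c \<Rightarrow> 'a \<Rightarrow> real"
  proof (intro sets.sets_Collect_finite_Ex that(1))
    fix j assume "j \<in> J"
    from measurable_sets[OF that(2)[OF this] G] show "{\<omega>\<in>space M. U j \<omega> \<in> G} \<in> events"
      by (simp only: vimage_def Int_def mem_Collect_eq conj_commute)
  qed
  have Zv: "Z (v i) \<in> borel_measurable M" and Wv: "W (q (v i)) \<in> borel_measurable M" if "i < Suc n" for i
    using Z_measurable Wm q_nonneg v_nonneg[OF that] by auto
  have same: "AE \<omega> in M. Z u \<omega> = Z (p (q u)) \<omega>" if u: "u \<in> I" for u
  proof -
    have "q u \<in> S" using u by (simp add: S_def)
    then have pu: "p (q u) \<in> I" "q (p (q u)) = q u" using p by auto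
    show ?thesis
    proof (cases "u \<le> p (q u)")
      case True
      have "AE \<omega> in M. Z (p (q u)) \<omega> = Z u \<omega>"
        using u I(3) True pu(2) by (intro AE_constant_on_flat_pieces) auto
      then show ?thesis by eventually_elim simp
    next
      case False
      then show ?thesis
        using I(3) pu by (intro AE_constant_on_flat_pieces) auto
    qed
  qed
  have idx: "\<exists>j\<in>{..n}. q u = xs ! j" if "u \<in> I" for u
  proof -
    have "q u \<in> set xs" using that by (simp add: set_xs S_def)
    then obtain j where "j < length xs" "xs ! j = q u" by (auto simp: in_set_conv_nth)
    then show ?thesis using len by (intro bexI[of _ j]) auto
  qed
  have v_in: "v j \<in> I" "p (q (v j)) = v j" if "j \<in> {..n}" for j
    using that p(1)[OF xs_in[of j]] qv[of j] by (auto simp: v_def less_Suc_eq_le)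
  \<comment> \<open>Finiteness of I unites the exceptional null sets, one for each time and its
    representative.\<close>
  have "AE \<omega> in M. \<forall>u\<in>I. Z u \<omega> = Z (p (q u)) \<omega>"
    using I(1) same by (intro AE_finite_allI) auto
  then have aeZ: "AE \<omega> in M. \<omega> \<in> {\<omega>\<in>space M. \<exists>u\<in>I. Z u \<omega> \<in> G} \<longleftrightarrow> \<omega> \<in> {\<omega>\<in>space M. \<exists>j\<in>{..n}. Z (v j) \<omega> - Z (v 0) \<omega> \<in> G}"
    using Z_0
  proof eventually_elim
    fix \<omega> assume *: "\<forall>u\<in>I. Z u \<omega> = Z (p (q u)) \<omega>" and "Z 0 \<omega> = 0"
    \<comment> \<open>The representative \<open>v 0\<close> of clock value 0 may be a positive time
      on an initial flat piece of q; Z still has its initial value there.\<close>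
    have "Z (v 0) \<omega> = 0"
      using bspec[OF *(1) I(2)] \<open>Z 0 \<omega> = 0\<close> by (simp add: v_def xs0 q_0)
    moreover have "(\<exists>u\<in>I. Z u \<omega> \<in> G) \<longleftrightarrow> (\<exists>j\<in>{..n}. Z (v j) \<omega> \<in> G)"
    proof
      assume "\<exists>u\<in>I. Z u \<omega> \<in> G"
      then obtain u where u: "u \<in> I" "Z u \<omega> \<in> G" by blast
      obtain j where j: "j \<in> {..n}" "q u = xs ! j" using idx[OF u(1)] by blast
      then have "Z (v j) \<omega> = Z u \<omega>" using bspec[OF *(1) u(1)] by (simp add: v_def)
      then show "\<exists>j\<in>{..n}. Z (v j) \<omega> \<in> G" using u j by (intro bexI[of _ j]) simp_all
    qed (use v_in(1) in blast)
    ultimately show "\<omega> \<in> {\<omega>\<in>space M. \<exists>u\<in>I. Z u \<omega> \<in> G} \<longleftrightarrow> \<omega> \<in> {\<omega>\<in>space M. \<exists>j\<in>{..n}. Z (v j) \<omega> - Z (v 0) \<omega> \<in> G}"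
      by simp
  qed
  have aeW: "AE \<omega> in M. \<omega> \<in> {\<omega>\<in>space M. \<exists>j\<in>{..n}. W (q (v j)) \<omega> - W (q (v 0)) \<omega> \<in> G} \<longleftrightarrow> \<omega> \<in> {\<omega>\<in>space M. \<exists>u\<in>I. W (q u) \<omega> \<in> G}"
    using wiener_processD(2)[OF W]
  proof eventually_elim
    fix \<omega> assume "W 0 \<omega> = 0"
    then have "W (q (v 0)) \<omega> = 0" using qv[of 0] by (simp add: xs0)
    moreover have "(\<exists>u\<in>I. W (q u) \<omega> \<in> G) \<longleftrightarrow> (\<exists>j\<in>{..n}. W (q (v j)) \<omega> \<in> G)"
    proof
      assume "\<exists>u\<in>I. W (q u) \<omega> \<in> G"
      then obtain u where u: "u \<in> I" "W (q u) \<omega> \<in> G" by blast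
      obtain j where j: "j \<in> {..n}" "q u = xs ! j" using idx[OF u(1)] by blast
      then have "q (v j) = q u" using qv[of j] by (simp add: less_Suc_eq_le)
      then show "\<exists>j\<in>{..n}. W (q (v j)) \<omega> \<in> G" using u j by (intro bexI[of _ j]) simp_all
    qed (use v_in(1) in blast)
    ultimately show "\<omega> \<in> {\<omega>\<in>space M. \<exists>j\<in>{..n}. W (q (v j)) \<omega> - W (q (v 0)) \<omega> \<in> G} \<longleftrightarrow> \<omega> \<in> {\<omega>\<in>space M. \<exists>u\<in>I. W (q u) \<omega> \<in> G}"
      by simp
  qed
  have "prob {\<omega>\<in>space M. \<exists>u\<in>I. Z u \<omega> \<in> G} = prob {\<omega>\<in>space M. \<exists>j\<in>{..n}. Z (v j) \<omega> - Z (v 0) \<omega> \<in> G}"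
  proof (rule measure_eq_AE[OF aeZ])
    show "{\<omega>\<in>space M. \<exists>u\<in>I. Z u \<omega> \<in> G} \<in> events"
      using I by (intro reach_meas Z_measurable) auto
    show "{\<omega>\<in>space M. \<exists>j\<in>{..n}. Z (v j) \<omega> - Z (v 0) \<omega> \<in> G} \<in> events"
      using Zv by (intro reach_meas[of "{..n}" "\<lambda>j \<omega>. Z (v j) \<omega> - Z (v 0) \<omega>"] borel_measurable_diff) auto
  qed
  also have "\<dots> = measure (distr M ?P (\<lambda>\<omega>. \<lambda>i\<in>{..<n}. Z (v (Suc i)) \<omega> - Z (v i) \<omega>)) T"
    by (rule law[of "\<lambda>i. Z (v i)"]) (rule Zv)
  also have "\<dots> = measure (distr M ?P (\<lambda>\<omega>. \<lambda>i\<in>{..<n}. W (q (v (Suc i))) \<omega> - W (q (v i)) \<omega>)) T"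
  proof -
    have "distr M ?P (\<lambda>\<omega>. \<lambda>i\<in>{..<n}. Z (v (Suc i)) \<omega> - Z (v i) \<omega>) =
      distr M ?P (\<lambda>\<omega>. \<lambda>i\<in>{..<n}. W (q (v (Suc i))) \<omega> - W (q (v i)) \<omega>)"
    proof (rule increments_same_law[of W v n, OF W])
      show "0 \<le> v 0" by (rule v_nonneg[OF zero_less_Suc])
    qed (rule Wm v_le q_less, assumption)+
    then show ?thesis by (rule arg_cong[where f="\<lambda>N. measure N T"])
  qed
  also have "\<dots> = prob {\<omega>\<in>space M. \<exists>j\<in>{..n}. W (q (v j)) \<omega> - W (q (v 0)) \<omega> \<in> G}"
    by (rule law[of "\<lambda>i. W (q (v i))", symmetric]) (rule Wv)
  also have "\<dots> = prob {\<omega>\<in>space M. \<exists>u\<in>I. W (q u) \<omega> \<in> G}"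
  proof (rule measure_eq_AE[OF aeW])
    show "{\<omega>\<in>space M. \<exists>u\<in>I. W (q u) \<omega> \<in> G} \<in> events"
      using I q_nonneg by (intro reach_meas Wm) auto
    show "{\<omega>\<in>space M. \<exists>j\<in>{..n}. W (q (v j)) \<omega> - W (q (v 0)) \<omega> \<in> G} \<in> events"
      using Wv by (intro reach_meas[of "{..n}" "\<lambda>j \<omega>. W (q (v j)) \<omega> - W (q (v 0)) \<omega>"] borel_measurable_diff) auto
  qed
  finally show ?thesis .
qed

text \<open>The passage times themselves are not transformed. For a continuous path each event only
  asks whether a value outside the corridor is visited, and both sides visit the same values of
  W.\<close>

lemma crossing_probability_clock:
  assumes cont: "continuous_process M W" and Wm: "\<And>t. 0 \<le> t \<Longrightarrow> W t \<in> borel_measurable M" and t: "0 \<le> t"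
  shows "continuous_process M (\<lambda>u. W (q u))"
    and "crossing_probability M (\<lambda>u. W (q u)) g h t = crossing_probability M W g h (q t)"
proof -
  have c': "continuous_on {0..} (\<lambda>u. W (q u) \<omega>)" if "continuous_on {0..} (\<lambda>t. W t \<omega>)" for \<omega>
    by (rule continuous_on_compose2[OF that q_continuous]) (use q_nonneg in auto)
  show Wq: "continuous_process M (\<lambda>u. W (q u))"
    using cont unfolding continuous_process_def by eventually_elim (rule c')
  show "crossing_probability M (\<lambda>u. W (q u)) g h t = crossing_probability M W g h (q t)"
    unfolding crossing_probability_def
  proof (rule measure_eq_AE)
    show "{\<omega>\<in>space M. first_passage_time (\<lambda>u. W (q u)) g h \<omega> \<le> ennreal t} \<in> events"
      by (rule crossing_probability_eq_grid(1)[OF Wq Wm[OF q_nonneg] t])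
    show "{\<omega>\<in>space M. first_passage_time W g h \<omega> \<le> ennreal (q t)} \<in> events"
      by (rule crossing_probability_eq_grid(1)[OF cont Wm q_nonneg[OF t]])
    show "AE \<omega> in M. \<omega> \<in> {\<omega>\<in>space M. first_passage_time (\<lambda>u. W (q u)) g h \<omega> \<le> ennreal t} \<longleftrightarrow>
      \<omega> \<in> {\<omega>\<in>space M. first_passage_time W g h \<omega> \<le> ennreal (q t)}"
      using cont[unfolded continuous_process_def]
    proof eventually_elim
      fix \<omega> assume c: "continuous_on {0..} (\<lambda>t. W t \<omega>)"
      have img: "q ` {0..t} = {0..q t}"
      proof
        show "q ` {0..t} \<subseteq> {0..q t}" using q_nonneg q_mono[of _ t] by auto
        show "{0..q t} \<subseteq> q ` {0..t}"
        proof
          fix r assume r: "r \<in> {0..q t}"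
          have "continuous_on {0..t} q" by (rule continuous_on_subset[OF q_continuous]) auto
          then obtain u where "0 \<le> u" "u \<le> t" "q u = r"
            using IVT'[of q 0 r t] r t q_0 by auto
          then show "r \<in> q ` {0..t}" by auto
        qed
      qed
      have "(\<exists>u\<in>{0..t}. 0 \<le> max (W (q u) \<omega> - g) (h - W (q u) \<omega>)) \<longleftrightarrow> (\<exists>r\<in>{0..q t}. 0 \<le> max (W r \<omega> - g) (h - W r \<omega>))"
        unfolding img[symmetric] by blast
      then show "\<omega> \<in> {\<omega>\<in>space M. first_passage_time (\<lambda>u. W (q u)) g h \<omega> \<le> ennreal t} \<longleftrightarrow>
        \<omega> \<in> {\<omega>\<in>space M. first_passage_time W g h \<omega> \<le> ennreal (q t)}"
        by (simp only: mem_Collect_eq first_passage_time_le_iff[of "\<lambda>u. W (q u)", OF c'[OF c] t]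
            first_passage_time_le_iff[of W, OF c q_nonneg[OF t]])
    qed
  qed
qed

end

theorem theorem2p6:
  fixes M :: "'a measure" and F :: "real \<Rightarrow> 'a measure"
    and Z W :: "real \<Rightarrow> 'a \<Rightarrow> real" and qv :: "real \<Rightarrow> real" and g h :: real
  assumes "stochastic_basis M F"
    and "0 < g" and "h < 0"
    and "continuous_process M Z" and "local_martingale M F Z"
    and "AE \<omega> in M. Z 0 \<omega> = 0"
    and "is_quadratic_variation M F Z (\<lambda>t \<omega>. qv t)"
    and "filterlim qv at_top at_top"
    and "wiener_process M W" and "adapted_process F W"
  shows "\<forall>t\<ge>0. crossing_probability M Z g h t = crossing_probability M W g h (qv t)"
proof (intro allI impI)
  fix t :: real assume t: "0 \<le> t"
  interpret stochastic_basis M F by fact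
  interpret deterministic_quadratic_variation M F Z qv
    by unfold_locales fact+
  have Wm: "W u \<in> borel_measurable M" if "0 \<le> u" for u
    using assms(10) measurable_F_M[OF that] that by (auto simp: adapted_process_def)
  note clock = crossing_probability_clock[OF wiener_processD(1)[OF assms(9)] Wm t]
  have "crossing_probability M Z g h t = crossing_probability M (\<lambda>u. W (qv u)) g h t"
  proof (rule crossing_probability_cong[OF Z_continuous _ clock(1) _ t])
    show "Z u \<in> borel_measurable M" if "0 \<le> u" for u by (rule Z_measurable[OF that])
    show "W (qv u) \<in> borel_measurable M" if "0 \<le> u" for u by (rule Wm[OF q_nonneg[OF that]])
    show "prob {\<omega>\<in>space M. \<exists>u\<in>I. Z u \<omega> \<in> G} = prob {\<omega>\<in>space M. \<exists>u\<in>I. W (qv u) \<omega> \<in> G}"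
      if "finite I" "0 \<in> I" "I \<subseteq> {0..}" "G \<in> sets borel" for I G
      by (rule reach_prob_eq[OF assms(9) _ that]) (rule Wm)
  qed
  also have "\<dots> = crossing_probability M W g h (qv t)" by (rule clock(2))
  finally show "crossing_probability M Z g h t = crossing_probability M W g h (qv t)" .
qed

end
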